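(* Let $\lambda\in[0,1)$, $\delta_1\in(0,1)$, $\delta_0>0$, put $\delta=\lambda\delta_1+(1-\lambda)\delta_0$, and let $(\alpha,S)$ be a phase-type job size distribution with mean $1$. Put $$\tilde m=\frac{\log(1-\lambda\delta_1/\delta)}{\log(1-\delta_1)} .$$ Then $1-\lambda\in[\pi_0(\lceil\tilde m\rceil),\pi_0(\lfloor\tilde m\rfloor)]$, where $\pi_0(m)=\pi_0(m,0)$. Hence $\lceil\tilde m\rceil$ is the maximum queue length of the queue at the cavity of the pull policy.
   Context: Job sizes have a phase-type (PH) distribution $(\alpha,S)$: $\alpha$ is a probability row vector of length $n_s$, $S$ an invertible $n_s\times n_s$ subgenerator matrix, $s^*=-S\mathbf 1$ ($\mathbf 1$ the all-ones column), and the mean is $\alpha(-S)^{-1}\mathbf 1=1$. In the pull policy a server reports its queue length with probability $\delta_1$ at each job completion and at rate $\delta_0$ when idle. Pull policy chain: for an integer $m\ge 0$ and a real $\nu\ge 0$, consider the continuous-time Markov chain on the states $(0,e)$ and $(q,e,j)$ with $e\in\{m,m+1\}$, $1\le q\le e$, $1\le j\le n_s$ ($q$ = actual queue length, $e$ = estimated queue length, $j$ = service phase), with the following transitions. (i) Phase changes: $(q,e,j)\to(q,e,j')$ at rate $S_{jj'}$, $j\ne j'$. (ii) Completions without update: $(q,e,j)\to(q-1,e,j')$ at rate $(1-\delta_1)s^*_j\alpha_{j'}$ if $q\ge2$; $(1,e,j)\to(0,e)$ at rate $(1-\delta_1)s_j^*$. (iii) Completions with update: $(q,e,j)\to(m,m,j')$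 at rate $\delta_1s^*_j\alpha_{j'}$ if $m\ge1$ (if $m=0$: $(1,1,j)\to(0,0)$ at rate $\delta_1s^*_j$). (iv) Idle updates: $(0,e)\to(m,m,j')$ at rate $\delta_0\alpha_{j'}$ if $m\ge1$ (if $m=0$: $(0,e)\to(0,0)$ at rate $\delta_0$). (v) Job assignments: $(q,m,j)\to(q+1,m+1,j)$ at rate $\nu$ for $q\ge1$; $(0,m)\to(1,m+1,j')$ at rate $\nu\alpha_{j'}$. Let $\pi_q(m,\nu)$ be the stationary probability that the actual queue length is $q$; in particular $\pi_0(0,0)=1$. Queue at the cavity: the stationary chain for the unique pair $(m,\nu)$, $m\in\{0,1,2,\dots\}$, $\nu\in[0,\infty)$, with $\pi_0(m,\nu)=1-\lambda$. Its maximum queue length is the largest $q$ with $\pi_q(m,\nu)>0$. *)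

theory Defs
  imports "HOL-Analysis.Analysis"
begin

definition subgenerator :: "real^'n^'n \<Rightarrow> bool" where
  "subgenerator S \<longleftrightarrow> (\<forall>i j. i \<noteq> j \<longrightarrow> 0 \<le> S $ i $ j) \<and> (\<forall>i. (\<Sum>j\<in>UNIV. S $ i $ j) \<le> 0)"

definition phase_type :: "real^'n \<Rightarrow> real^'n^'n \<Rightarrow> bool" where
  "phase_type \<alpha> S \<longleftrightarrow>
     (\<forall>i. 0 \<le> \<alpha> $ i) \<and> (\<Sum>i\<in>UNIV. \<alpha> $ i) = 1 \<and> subgenerator S \<and> invertible S"

definition ph_mean :: "real^'n \<Rightarrow> real^'n^'n \<Rightarrow> real" where
  "ph_mean \<alpha> S = \<alpha> \<bullet> (matrix_inv (- S) *v vec 1)"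

definition exit_rate :: "real^'n^'n \<Rightarrow> real^'n" where
  "exit_rate S = - (S *v vec 1)"

text \<open>\<open>Idle e\<close> is the state $(0,e)$ and \<open>Busy q e j\<close> is the state $(q,e,j)$. The type itself does not
  impose the bounds on \<open>q\<close> and \<open>e\<close>; these are in \<open>pull_states\<close>.\<close>

datatype 'n pull_state = Idle nat | Busy nat nat 'n

definition pull_states :: "nat \<Rightarrow> 'n pull_state set" where
  "pull_states m = {Idle e |e. e \<in> {m, m + 1}} \<union>
                   {Busy q e j |q e j. e \<in> {m, m + 1} \<and> 1 \<le> q \<and> q \<le> e}"

fun queue_length :: "'n pull_state \<Rightarrow> nat" where
  "queue_length (Idle e) = 0"
| "queue_length (Busy q e j) = q"

fun phase_rate :: "real^'n^'n \<Rightarrow> 'n pull_state \<Rightarrow> 'n pull_state \<Rightarrow> real" where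
  "phase_rate S (Busy q e j) (Busy q' e' j') =
     (if q' = q \<and> e' = e \<and> j' \<noteq> j then S $ j $ j' else 0)"
| "phase_rate S _ _ = 0"

fun silent_completion_rate ::
  "real^'n \<Rightarrow> real^'n^'n \<Rightarrow> real \<Rightarrow> 'n pull_state \<Rightarrow> 'n pull_state \<Rightarrow> real" where
  "silent_completion_rate \<alpha> S \<delta>1 (Busy q e j) (Busy q' e' j') =
     (if 2 \<le> q \<and> q' = q - 1 \<and> e' = e then (1 - \<delta>1) * exit_rate S $ j * \<alpha> $ j' else 0)"
| "silent_completion_rate \<alpha> S \<delta>1 (Busy q e j) (Idle e') =
     (if q = 1 \<and> e' = e then (1 - \<delta>1) * exit_rate S $ j else 0)"
| "silent_completion_rate \<alpha> S \<delta>1 (Idle e) _ = 0"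

fun update_completion_rate ::
  "real^'n \<Rightarrow> real^'n^'n \<Rightarrow> real \<Rightarrow> nat \<Rightarrow> 'n pull_state \<Rightarrow> 'n pull_state \<Rightarrow> real" where
  "update_completion_rate \<alpha> S \<delta>1 m (Busy q e j) (Busy q' e' j') =
     (if 1 \<le> m \<and> q' = m \<and> e' = m then \<delta>1 * exit_rate S $ j * \<alpha> $ j' else 0)"
| "update_completion_rate \<alpha> S \<delta>1 m (Busy q e j) (Idle e') =
     (if m = 0 \<and> e' = 0 then \<delta>1 * exit_rate S $ j else 0)"
| "update_completion_rate \<alpha> S \<delta>1 m (Idle e) _ = 0"

fun idle_update_rate ::
  "real^'n \<Rightarrow> real \<Rightarrow> nat \<Rightarrow> 'n pull_state \<Rightarrow> 'n pull_state \<Rightarrow> real" where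
  "idle_update_rate \<alpha> \<delta>0 m (Idle e) (Busy q' e' j') =
     (if 1 \<le> m \<and> q' = m \<and> e' = m then \<delta>0 * \<alpha> $ j' else 0)"
| "idle_update_rate \<alpha> \<delta>0 m (Idle e) (Idle e') = (if m = 0 \<and> e' = 0 then \<delta>0 else 0)"
| "idle_update_rate \<alpha> \<delta>0 m (Busy q e j) _ = 0"

fun assignment_rate ::
  "real^'n \<Rightarrow> nat \<Rightarrow> real \<Rightarrow> 'n pull_state \<Rightarrow> 'n pull_state \<Rightarrow> real" where
  "assignment_rate \<alpha> m \<nu> (Busy q e j) (Busy q' e' j') =
     (if e = m \<and> q' = q + 1 \<and> e' = m + 1 \<and> j' = j then \<nu> else 0)"
| "assignment_rate \<alpha> m \<nu> (Idle e) (Busy q' e' j') =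
     (if e = m \<and> q' = 1 \<and> e' = m + 1 then \<nu> * \<alpha> $ j' else 0)"
| "assignment_rate \<alpha> m \<nu> _ (Idle e') = 0"

text \<open>Different transitions may join the same two states (a phase change and a completion with
  update, for instance), so their rates are added.\<close>

definition pull_rate ::
  "real^'n \<Rightarrow> real^'n^'n \<Rightarrow> real \<Rightarrow> real \<Rightarrow> nat \<Rightarrow> real \<Rightarrow> 'n pull_state \<Rightarrow> 'n pull_state \<Rightarrow> real"
where
  "pull_rate \<alpha> S \<delta>0 \<delta>1 m \<nu> x y =
     phase_rate S x y + silent_completion_rate \<alpha> S \<delta>1 x y + update_completion_rate \<alpha> S \<delta>1 m x y +
     idle_update_rate \<alpha> \<delta>0 m x y + assignment_rate \<alpha> m \<nu> x y"

text \<open>Transitions from a state to itself (an update in state $(m,m,j)$ whose next job starts in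
  phase \<open>j\<close>, an idle update in $(0,0)$ for $m = 0$) do not enter the generator.\<close>

definition pull_generator ::
  "real^'n \<Rightarrow> real^'n^'n \<Rightarrow> real \<Rightarrow> real \<Rightarrow> nat \<Rightarrow> real \<Rightarrow> 'n pull_state \<Rightarrow> 'n pull_state \<Rightarrow> real"
where
  "pull_generator \<alpha> S \<delta>0 \<delta>1 m \<nu> x y =
     (if x = y then - (\<Sum>z\<in>pull_states m - {x}. pull_rate \<alpha> S \<delta>0 \<delta>1 m \<nu> x z)
      else pull_rate \<alpha> S \<delta>0 \<delta>1 m \<nu> x y)"

definition is_stationary ::
  "real^'n \<Rightarrow> real^'n^'n \<Rightarrow> real \<Rightarrow> real \<Rightarrow> nat \<Rightarrow> real \<Rightarrow> ('n pull_state \<Rightarrow> real) \<Rightarrow> bool"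
where
  "is_stationary \<alpha> S \<delta>0 \<delta>1 m \<nu> p \<longleftrightarrow>
     (\<forall>x\<in>pull_states m. 0 \<le> p x) \<and> (\<forall>x. x \<notin> pull_states m \<longrightarrow> p x = 0) \<and>
     (\<Sum>x\<in>pull_states m. p x) = 1 \<and>
     (\<forall>y\<in>pull_states m. (\<Sum>x\<in>pull_states m. p x * pull_generator \<alpha> S \<delta>0 \<delta>1 m \<nu> x y) = 0)"

definition stationary_dist ::
  "real^'n \<Rightarrow> real^'n^'n \<Rightarrow> real \<Rightarrow> real \<Rightarrow> nat \<Rightarrow> real \<Rightarrow> 'n pull_state \<Rightarrow> real"
where
  "stationary_dist \<alpha> S \<delta>0 \<delta>1 m \<nu> = (THE p. is_stationary \<alpha> S \<delta>0 \<delta>1 m \<nu> p)"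

text \<open>\<open>queue_prob \<alpha> S \<delta>0 \<delta>1 q m \<nu>\<close> is $\pi_q(m,\nu)$.\<close>

definition queue_prob ::
  "real^'n \<Rightarrow> real^'n^'n \<Rightarrow> real \<Rightarrow> real \<Rightarrow> nat \<Rightarrow> nat \<Rightarrow> real \<Rightarrow> real"
where
  "queue_prob \<alpha> S \<delta>0 \<delta>1 q m \<nu> =
     (\<Sum>x\<in>{x \<in> pull_states m. queue_length x = q}. stationary_dist \<alpha> S \<delta>0 \<delta>1 m \<nu> x)"

definition cavity_parameters ::
  "real^'n \<Rightarrow> real^'n^'n \<Rightarrow> real \<Rightarrow> real \<Rightarrow> real \<Rightarrow> nat \<times> real"
where
  "cavity_parameters \<alpha> S \<delta>0 \<delta>1 lam =
     (THE p. 0 \<le> snd p \<and> queue_prob \<alpha> S \<delta>0 \<delta>1 0 (fst p) (snd p) = 1 - lam)"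

definition cavity_max_queue_length ::
  "real^'n \<Rightarrow> real^'n^'n \<Rightarrow> real \<Rightarrow> real \<Rightarrow> real \<Rightarrow> nat"
where
  "cavity_max_queue_length \<alpha> S \<delta>0 \<delta>1 lam =
     (let (m, \<nu>) = cavity_parameters \<alpha> S \<delta>0 \<delta>1 lam
      in Max {q. 0 < queue_prob \<alpha> S \<delta>0 \<delta>1 q m \<nu>})"

end

theory Submission imports Defs begin

text \<open>Fix the flow of updates to be 1. The balance equations then determine the stationary vector
  uniquely, level by level from the top, in terms of the resolvent $K_\nu = (\nu I - S)^{-1}$. Since
  every started job is completed and has mean 1, the busy mass equals the completion rate, so the
  chain is governed by a single number: the fraction $\rho$ of updates sent by an idle server, with
  $\pi_0 = \delta_1 \rho / (\delta_1 \rho + \delta_0 (1 - \rho))$. With $r = 1 - \delta_1$ and $\phi$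
  the Laplace transform of the job size,
  $\rho = r^m (r + \delta_1 \phi(\nu)^m \delta_0 / (\delta_0 + \nu))$, which decreases continuously and
  strictly from $r^m$ at $\nu = 0$ to the limit $r^{m+1}$. Hence $(m, \nu) \mapsto \rho$ is a bijection
  onto $(0, 1]$; the value $\pi_0 = 1 - \lambda$ corresponds to $\rho = 1 - \lambda \delta_1 / \delta$,
  that is, to $m = \lfloor \tilde m \rfloor$, with $\nu = 0$ exactly when $\tilde m$ is an integer.\<close>

section \<open>Resolvents of subgenerators\<close>

lemma mat_mult_vec: "mat k *v (z::real^'n) = k *\<^sub>R z"
  by (simp add: vec_eq_iff matrix_vector_mult_def mat_def if_distrib if_distribR cong: if_cong)

lemma matrix_uminus_vec: "(- A) *v x = - (A *v x)" for A :: "real^'n^'m"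
  by (simp add: vec_eq_iff matrix_vector_mult_def sum_negf)

lemma shift_mult_vec: "(mat k - A) *v z = k *\<^sub>R z - A *v z" for A :: "real^'n^'n"
  by (simp add: matrix_vector_mult_diff_rdistrib mat_mult_vec)

text \<open>A minimum principle. At an index \<open>k\<close> where \<open>z\<close> is smallest,
  the off-diagonal entries of \<open>S\<close> multiply nonnegative differences; if
  \<open>z $ k\<close> were negative, the nonpositive row sum would contribute a nonnegative term as
  well. Then \<open>(S *v z) $ k\<close> is nonnegative and the shifted matrix gives a negative
  value at \<open>k\<close>.\<close>

lemma subgenerator_shift_nonneg:
  fixes S :: "real^'n^'n"
  assumes S: "subgenerator S" and "0 < \<nu>" and nonneg: "\<And>i. 0 \<le> ((mat \<nu> - S) *v z) $ i"
  shows "0 \<le> z $ i"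
proof -
  obtain k where k: "\<And>j. z $ k \<le> z $ j"
    using ex_is_arg_min_if_finite[of "UNIV::'n set" "\<lambda>j. z $ j"]
    by (auto simp: is_arg_min_linorder)
  have "0 \<le> z $ k"
  proof (rule ccontr)
    assume neg: "\<not> 0 \<le> z $ k"
    have "0 \<le> (\<Sum>j\<in>UNIV. S $ k $ j * (z $ j - z $ k))"
      using S k by (intro sum_nonneg) (metis diff_ge_0_iff_ge diff_self mult_nonneg_nonneg mult_zero_right order_refl subgenerator_def)
    moreover have "0 \<le> (\<Sum>j\<in>UNIV. S $ k $ j) * z $ k"
      using S neg by (auto simp: subgenerator_def intro: mult_nonpos_nonpos)
    ultimately have "0 \<le> (S *v z) $ k"
      by (simp add: matrix_vector_mult_def algebra_simps sum_subtractf flip: sum_distrib_left)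
    moreover have "\<nu> * z $ k < 0"
      using neg \<open>0 < \<nu>\<close> by (simp add: mult_pos_neg)
    ultimately show False
      using nonneg[of k] by (simp add: shift_mult_vec)
  qed
  with k show ?thesis by (meson order_trans)
qed

definition resolvent :: "real^'n^'n \<Rightarrow> real \<Rightarrow> real^'n^'n" where
  "resolvent S \<nu> = matrix_inv (mat \<nu> - S)"

text \<open>For positive \<nu>, the minimum principle applied to a kernel vector and to its negative
  forces it to vanish. That principle needs \<nu> positive, so the case \<nu> = 0 rests on the
  invertibility of \<open>S\<close> itself.\<close>

lemma invertible_shift:
  fixes S :: "real^'n^'n"
  assumes S: "subgenerator S" "invertible S" and "0 \<le> \<nu>"
  shows "invertible (mat \<nu> - S)"
proof -
  have "z = 0" if "(mat \<nu> - S) *v z = 0" for z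
  proof (cases "\<nu> = 0")
    case True
    with that have "S *v z = S *v 0" by (simp add: matrix_uminus_vec)
    with S(2) show ?thesis by (metis inj_matrix_vector_mult injD)
  next
    case False
    have "0 \<le> z $ i" for i
      using subgenerator_shift_nonneg[OF S(1), of \<nu> z] that False \<open>0 \<le> \<nu>\<close> by simp
    moreover have "(mat \<nu> - S) *v (- z) = 0"
      using that linear_neg[OF matrix_vector_mul_linear, of "mat \<nu> - S" z] by simp
    then have "0 \<le> (- z) $ i" for i
      using subgenerator_shift_nonneg[OF S(1), of \<nu> "- z"] False \<open>0 \<le> \<nu>\<close> by simp
    ultimately show ?thesis by (simp add: vec_eq_iff order_antisym)
  qed
  then show ?thesis
    using invertible_left_inverse matrix_left_invertible_ker by blast
qed

lemma resolvent_inverse: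
  fixes S :: "real^'n^'n"
  assumes "subgenerator S" "invertible S" and "0 \<le> \<nu>"
  shows "(mat \<nu> - S) ** resolvent S \<nu> = mat 1" "resolvent S \<nu> ** (mat \<nu> - S) = mat 1"
  using someI_ex[OF invertible_shift[OF assms, unfolded invertible_def]]
  unfolding resolvent_def matrix_inv_def by blast+

text \<open>The minimum principle settles positive \<nu>. For \<nu> = 0 the result is reached as a
  limit: the vectors \<open>K \<epsilon> *v b\<close> are nonnegative and differ from
  \<open>K 0 *v b\<close> by O(\<epsilon>).\<close>

lemma resolvent_nonneg:
  fixes S :: "real^'n^'n"
  assumes S: "subgenerator S" "invertible S" and "0 \<le> \<nu>" and b: "\<And>i. 0 \<le> b $ i"
  shows "0 \<le> (resolvent S \<nu> *v b) $ i"
proof (cases "\<nu> = 0")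
  case False
  show ?thesis
    by (rule subgenerator_shift_nonneg[of S \<nu>])
      (use False assms in \<open>simp_all add: matrix_vector_mul_assoc resolvent_inverse\<close>)
next
  case True
  define K where "K = resolvent S"
  define z where "z = K 0 *v b"
  obtain C where C: "0 < C" "\<And>w. norm (K 0 *v w) \<le> norm w * C"
    using bounded_linear.pos_bounded[OF matrix_vector_mul_bounded_linear[of "K 0"]] by blast
  \<comment> \<open>The condition on \<open>\<epsilon> * C\<close> allows half of
    \<open>norm z'\<close> to be absorbed on the left, so that \<open>norm z'\<close> is at most
    \<open>2 * norm z\<close> uniformly in \<epsilon>.\<close>
  have bound: "- (\<epsilon> * C * (2 * norm z)) \<le> z $ i" if "0 < \<epsilon>" "\<epsilon> * C \<le> 1/2" for \<epsilon>
  proof -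
    define z' where "z' = K \<epsilon> *v b"
    have "0 \<le> z' $ i"
      unfolding z'_def K_def
      by (rule subgenerator_shift_nonneg[of S \<epsilon>])
        (use that assms in \<open>simp_all add: matrix_vector_mul_assoc resolvent_inverse\<close>)
    have "(mat \<epsilon> - S) *v z' = b"
      using that S by (simp add: z'_def K_def matrix_vector_mul_assoc resolvent_inverse)
    then have "(mat 0 - S) *v z' = b - \<epsilon> *\<^sub>R z'"
      unfolding shift_mult_vec by (simp add: algebra_simps)
    then have "K 0 *v ((mat 0 - S) *v z') = K 0 *v (b - \<epsilon> *\<^sub>R z')" by simp
    then have z': "z' = z - \<epsilon> *\<^sub>R (K 0 *v z')"
      unfolding matrix_vector_mul_assoc K_def using S
      by (simp only: resolvent_inverse order_refl) (simp add: z_def K_def algebra_simps)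
    have "norm z' \<le> norm z + \<epsilon> * norm (K 0 *v z')"
      using that by (subst z') (metis abs_of_pos norm_scaleR norm_triangle_ineq4)
    also have "\<dots> \<le> norm z + \<epsilon> * (norm z' * C)"
      using C(2)[of z'] that by (simp add: mult_left_mono)
    also have "\<epsilon> * (norm z' * C) \<le> norm z' * (1/2)"
      using mult_left_mono[OF that(2), of "norm z'"] by (simp add: mult_ac)
    finally have *: "norm z' \<le> 2 * norm z" by simp
    have "\<bar>(K 0 *v z') $ i\<bar> \<le> norm z' * C"
      using C(2)[of z'] component_le_norm_cart order_trans by blast
    also have "\<dots> \<le> 2 * norm z * C"
      using * C(1) by (intro mult_right_mono) auto
    finally have "\<epsilon> * \<bar>(K 0 *v z') $ i\<bar> \<le> \<epsilon> * (2 * norm z * C)"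
      using that by (intro mult_left_mono) auto
    moreover have "z' $ i = z $ i - \<epsilon> * (K 0 *v z') $ i"
      by (subst z') simp
    moreover have "\<epsilon> * (K 0 *v z') $ i \<ge> - (\<epsilon> * \<bar>(K 0 *v z') $ i\<bar>)"
      using that by (metis abs_ge_minus_self abs_mult abs_of_pos minus_le_iff)
    ultimately show ?thesis
      using \<open>0 \<le> z' $ i\<close> by (simp add: mult_ac)
  qed
  have "0 \<le> z $ i"
  proof (rule tendsto_upperbound)
    show "((\<lambda>\<epsilon>. - (\<epsilon> * C * (2 * norm z))) \<longlongrightarrow> 0) (at_right 0)"
      by (auto intro!: tendsto_eq_intros)
    show "\<forall>\<^sub>F \<epsilon> in at_right 0. - (\<epsilon> * C * (2 * norm z)) \<le> z $ i"
      unfolding eventually_at_right_field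
      by (rule exI[of _ "1 / (2 * C)"]) (use C(1) bound in \<open>auto simp: field_simps\<close>)
  qed simp
  with True show ?thesis by (simp add: z_def K_def)
qed

section \<open>Laplace transform of a phase-type distribution\<close>

locale phase_type_dist =
  fixes \<alpha> :: "real^'n" and S :: "real^'n^'n"
  assumes phase_type: "phase_type \<alpha> S" and mean: "ph_mean \<alpha> S = 1"
begin

abbreviation K :: "real \<Rightarrow> real^'n^'n" where "K \<equiv> resolvent S"
abbreviation s :: "real^'n" where "s \<equiv> exit_rate S"

lemma alpha: "0 \<le> \<alpha> $ i" "(\<Sum>i\<in>UNIV. \<alpha> $ i) = 1"
  and S: "subgenerator S" "invertible S"
  using phase_type by (auto simp: phase_type_def)

lemmas K_inverse = resolvent_inverse[OF S]

lemma exit_rate_nonneg: "0 \<le> s $ i"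
  using S(1) by (simp add: exit_rate_def subgenerator_def matrix_vector_mult_def)

lemma K_nonneg: "0 \<le> \<nu> \<Longrightarrow> (\<And>i. 0 \<le> b $ i) \<Longrightarrow> 0 \<le> (K \<nu> *v b) $ i"
  by (rule resolvent_nonneg[OF S])

lemma row_K_nonneg:
  assumes "0 \<le> \<nu>" "\<And>i. 0 \<le> x $ i"
  shows "0 \<le> (x v* K \<nu>) $ i"
proof -
  have "(x v* K \<nu>) $ i = x \<bullet> (K \<nu> *v axis i 1)"
    by (simp add: dot_lmul_matrix[symmetric] inner_axis)
  also have "0 \<le> \<dots>"
    unfolding inner_vec_def using assms
    by (auto intro!: sum_nonneg mult_nonneg_nonneg K_nonneg simp: axis_def)
  finally show ?thesis .
qed

text \<open>The balance equations of a level are row equations of this shape; this is what turns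
  them into closed formulas.\<close>

lemma K_solve:
  assumes "0 \<le> \<nu>"
  shows "x v* (mat \<nu> - S) = b \<longleftrightarrow> x = b v* K \<nu>"
  using K_inverse[OF assms] by (metis vector_matrix_mul_assoc vector_matrix_mul_rid)

text \<open>Writing \<nu> as \<mu> + (\<nu> - \<mu>) in
  \<open>(mat \<nu> - S) *v (K \<nu> *v b) = b\<close> and applying \<open>K \<mu>\<close> gives the
  identity. Every comparison of different assignment rates below goes through it.\<close>

lemma resolvent_identity:
  assumes "0 \<le> \<mu>" "0 \<le> \<nu>"
  shows "K \<mu> *v b - K \<nu> *v b = (\<nu> - \<mu>) *\<^sub>R (K \<mu> *v (K \<nu> *v b))"
proof -
  let ?v = "K \<nu> *v b"
  have "(mat \<nu> - S) *v ?v = b"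
    using assms by (simp add: matrix_vector_mul_assoc K_inverse)
  moreover have "(mat \<nu> - S) *v ?v = (mat \<mu> - S) *v ?v + (\<nu> - \<mu>) *\<^sub>R ?v"
    unfolding shift_mult_vec by (simp add: algebra_simps)
  ultimately have "K \<mu> *v b = K \<mu> *v ((mat \<mu> - S) *v ?v) + (\<nu> - \<mu>) *\<^sub>R (K \<mu> *v ?v)"
    by (metis matrix_vector_right_distrib matrix_vector_mult_scaleR)
  then show ?thesis
    using assms by (simp add: matrix_vector_mul_assoc[of _ "mat \<mu> - S"] K_inverse)
qed

text \<open>From each phase, a job is completed with probability 1.\<close>

lemma K0_exit_rate: "K 0 *v s = 1"
proof -
  have "(mat 0 - S) *v 1 = s"
    unfolding shift_mult_vec by (simp add: exit_rate_def)
  then show ?thesis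
    using K_inverse(2)[of 0] by (metis matrix_vector_mul_assoc matrix_vector_mul_lid order_refl)
qed

lemma inner_one: "x \<bullet> 1 = (\<Sum>i\<in>UNIV. x $ i)" for x :: "real^'n"
  by (simp add: inner_vec_def)

text \<open>The first value is the mean job size, the second the probability that a job is ever
  completed. Their equality makes mass and completion flow interchangeable later.\<close>

lemma alpha_K0: "\<alpha> \<bullet> (K 0 *v 1) = 1" "\<alpha> \<bullet> (K 0 *v s) = 1"
  using mean alpha(2) unfolding K0_exit_rate by (simp_all add: ph_mean_def resolvent_def inner_one)

text \<open>The Laplace-Stieltjes transform of the job size in matrix form; it is also the
  probability that a job finishes before an exponential clock of rate \<nu> rings.\<close>

definition lst :: "real \<Rightarrow> real" where
  "lst \<nu> = \<alpha> \<bullet> (K \<nu> *v s)"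

lemma inner_nonneg: "(\<And>i. 0 \<le> x $ i) \<Longrightarrow> (\<And>i. 0 \<le> y $ i) \<Longrightarrow> 0 \<le> x \<bullet> y" for x y :: "real^'n"
  by (auto simp: inner_vec_def intro!: sum_nonneg mult_nonneg_nonneg)

lemma lst_0: "lst 0 = 1"
  by (simp add: lst_def alpha_K0)

lemma lst_diff: "0 \<le> \<mu> \<Longrightarrow> 0 \<le> \<nu> \<Longrightarrow> lst \<mu> - lst \<nu> = (\<nu> - \<mu>) * (\<alpha> \<bullet> (K \<mu> *v (K \<nu> *v s)))"
  using arg_cong[OF resolvent_identity[of \<mu> \<nu> s], of "(\<bullet>) \<alpha>"]
  by (simp add: lst_def inner_diff_right)

lemma lst_antimono:
  assumes "0 \<le> \<mu>" "\<mu> \<le> \<nu>"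
  shows "lst \<nu> \<le> lst \<mu>"
proof -
  have "0 \<le> \<alpha> \<bullet> (K \<mu> *v (K \<nu> *v s))"
    using assms by (intro inner_nonneg K_nonneg alpha exit_rate_nonneg) auto
  then have "0 \<le> lst \<mu> - lst \<nu>"
    using assms lst_diff[of \<mu> \<nu>] by simp
  then show ?thesis by simp
qed

lemma lst_le_1: "0 \<le> \<nu> \<Longrightarrow> lst \<nu> \<le> 1"
  using lst_antimono[of 0 \<nu>] by (simp add: lst_0)

text \<open>The constant 1 is the mean job size: \<open>K \<nu> *v s\<close> is at most 1 in each
  phase, and \<open>\<alpha> \<bullet> (K \<mu> *v 1)\<close> is at most
  \<open>\<alpha> \<bullet> (K 0 *v 1)\<close>, which is 1. Continuity of \<open>lst\<close> is what
  this serves.\<close>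

lemma lst_lipschitz:
  assumes "0 \<le> \<mu>" "\<mu> \<le> \<nu>"
  shows "lst \<mu> - lst \<nu> \<le> \<nu> - \<mu>"
proof -
  have 1: "0 \<le> (1 - K \<nu> *v s) $ i" for i
  proof -
    have "1 - K \<nu> *v s = \<nu> *\<^sub>R (K 0 *v (K \<nu> *v s))"
      using resolvent_identity[of 0 \<nu> s] assms by (simp add: K0_exit_rate)
    then show ?thesis
      using assms K_nonneg[of 0 "K \<nu> *v s"] K_nonneg[of \<nu> s] exit_rate_nonneg by simp
  qed
  have "0 \<le> \<alpha> \<bullet> (K \<mu> *v (1 - K \<nu> *v s))"
    using assms 1 by (intro inner_nonneg K_nonneg alpha) auto
  moreover have "0 \<le> \<mu> * (\<alpha> \<bullet> (K 0 *v (K \<mu> *v 1)))"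
    using assms by (intro mult_nonneg_nonneg inner_nonneg K_nonneg alpha) auto
  moreover have "1 - \<alpha> \<bullet> (K \<mu> *v 1) = \<mu> * (\<alpha> \<bullet> (K 0 *v (K \<mu> *v 1)))"
    using arg_cong[OF resolvent_identity[of 0 \<mu> "1"], of "(\<bullet>) \<alpha>"] assms
    by (simp add: inner_diff_right alpha_K0[simplified])
  ultimately have "\<alpha> \<bullet> (K \<mu> *v (K \<nu> *v s)) \<le> 1"
    by (simp add: algebra_simps inner_diff_right)
  then show ?thesis
    using assms lst_diff[of \<mu> \<nu>] mult_left_mono[of _ 1 "\<nu> - \<mu>"] by simp
qed

lemma continuous_on_lst: "continuous_on {0..} lst"
proof -
  have "1-lipschitz_on {0..} lst"
  proof (rule lipschitz_onI)
    fix x y :: real assume "x \<in> {0..}" "y \<in> {0..}"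
    then show "dist (lst x) (lst y) \<le> 1 * dist x y"
      using lst_lipschitz[of x y] lst_lipschitz[of y x] lst_antimono[of x y] lst_antimono[of y x]
      by (cases "x \<le> y") (auto simp: dist_real_def)
  qed simp
  then show ?thesis by (rule lipschitz_on_continuous_on)
qed

text \<open>If \<open>K \<nu> *v s\<close> vanished in some phase, the phases where it vanishes would form a set that
  cannot be left, contradicting the finiteness of the absorption time \<open>K 0 *v 1\<close>.\<close>

lemma K_exit_rate_pos:
  assumes "0 \<le> \<nu>"
  shows "0 < (K \<nu> *v s) $ i"
proof (rule ccontr)
  define v where "v = K \<nu> *v s"
  define h where "h = K 0 *v 1"
  define Z where "Z = {i. v $ i = 0}"
  assume "\<not> 0 < (K \<nu> *v s) $ i"
  moreover have v0: "0 \<le> v $ i" for i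
    unfolding v_def by (intro K_nonneg assms exit_rate_nonneg)
  ultimately have "i \<in> Z" by (simp add: Z_def v_def order_antisym)
  \<comment> \<open>\<open>h\<close> holds the mean absorption times, and \<open>k\<close> minimises
    them over \<open>Z\<close>. Since row \<open>k\<close> has no entries outside \<open>Z\<close>
    and row sum 0, minimality makes \<open>(S *v h) $ k\<close> nonnegative, whereas it equals
    -1.\<close>
  then obtain k where k: "k \<in> Z" and min: "\<And>j. j \<in> Z \<Longrightarrow> h $ k \<le> h $ j"
    using ex_is_arg_min_if_finite[of Z "\<lambda>j. h $ j"] by (auto simp: is_arg_min_linorder)
  have "(mat \<nu> - S) *v v = s"
    using assms by (simp add: v_def matrix_vector_mul_assoc K_inverse)
  then have "(S *v v) $ k = - s $ k"
    using k by (auto simp add: shift_mult_vec vec_eq_iff Z_def dest!: spec[of _ k])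
  moreover have nn: "0 \<le> S $ k $ j * v $ j" for j
    using S(1) k v0 by (cases "j = k") (auto simp: subgenerator_def Z_def)
  then have "0 \<le> (S *v v) $ k"
    unfolding matrix_vector_mult_def by (simp add: sum_nonneg)
  ultimately have sk: "s $ k = 0" and Sv: "(\<Sum>j\<in>UNIV. S $ k $ j * v $ j) = 0"
    using exit_rate_nonneg[of k] by (auto simp: matrix_vector_mult_def)
  have "S $ k $ j * v $ j = 0" for j
    using Sv nn by (simp add: sum_nonneg_eq_0_iff)
  then have S0: "S $ k $ j = 0" if "j \<notin> Z" for j
    using that by (auto simp: Z_def)
  have nn': "0 \<le> S $ k $ j * (h $ j - h $ k)" for j
    using S(1) S0 min by (cases "j = k"; cases "j \<in> Z") (auto simp: subgenerator_def)
  have "(mat 0 - S) *v h = 1"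
    unfolding h_def matrix_vector_mul_assoc by (simp only: K_inverse order_refl) simp
  then have "(S *v h) $ k = - 1"
    unfolding shift_mult_vec by (simp add: vec_eq_iff)
  then have "(\<Sum>j\<in>UNIV. S $ k $ j * (h $ j - h $ k)) = - 1 - (\<Sum>j\<in>UNIV. S $ k $ j) * h $ k"
    by (simp add: matrix_vector_mult_def algebra_simps sum_subtractf flip: sum_distrib_left)
  also have "(\<Sum>j\<in>UNIV. S $ k $ j) = 0"
    using sk by (simp add: exit_rate_def matrix_vector_mult_def)
  finally show False
    using sum_nonneg[of UNIV "\<lambda>j. S $ k $ j * (h $ j - h $ k)"] nn' by simp
qed

lemma lst_pos:
  assumes "0 \<le> \<nu>"
  shows "0 < lst \<nu>"
proof -
  obtain i where "\<alpha> $ i \<noteq> 0"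
    using alpha(2) by fastforce
  then have "0 < \<alpha> $ i * (K \<nu> *v s) $ i"
    using alpha(1)[of i] K_exit_rate_pos[OF assms, of i] by simp
  also have "\<dots> \<le> (\<Sum>i\<in>UNIV. \<alpha> $ i * (K \<nu> *v s) $ i)"
    by (intro member_le_sum mult_nonneg_nonneg alpha less_imp_le[OF K_exit_rate_pos[OF assms]]) auto
  finally show ?thesis by (simp add: lst_def inner_vec_def)
qed

end

section \<open>Transition flows of the pull chain\<close>

lemma Idle_in_pull_states [simp]: "Idle e \<in> pull_states m \<longleftrightarrow> e = m \<or> e = Suc m"
  by (auto simp: pull_states_def)

lemma Busy_in_pull_states [simp]:
  "Busy q e j \<in> pull_states m \<longleftrightarrow> (e = m \<or> e = Suc m) \<and> 1 \<le> q \<and> q \<le> e"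
  by (auto simp: pull_states_def)

lemma pull_states_eq:
  "(pull_states m :: 'n pull_state set) = {Idle m, Idle (Suc m)} \<union>
     (\<lambda>(q, j). Busy q m j) ` ({1..m} \<times> UNIV) \<union> (\<lambda>(q, j). Busy q (Suc m) j) ` ({1..Suc m} \<times> UNIV)"
  (is "?A = ?B")
proof (rule set_eqI)
  fix x :: "'n pull_state"
  show "x \<in> ?A \<longleftrightarrow> x \<in> ?B"
    by (cases x) (auto simp: image_iff)
qed

lemma finite_pull_states [simp]: "finite (pull_states m :: ('n::finite) pull_state set)"
  unfolding pull_states_eq by auto

lemma sum_pull_states:
  fixes f :: "('n::finite) pull_state \<Rightarrow> real"
  shows "(\<Sum>x\<in>pull_states m. f x) = f (Idle m) + f (Idle (Suc m)) +
    (\<Sum>q=1..m. \<Sum>j\<in>UNIV. f (Busy q m j)) + (\<Sum>q=1..Suc m. \<Sum>j\<in>UNIV. f (Busy q (Suc m) j))"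
proof -
  have 1: "sum f ((\<lambda>(q, j). Busy q e j) ` ({1..n} \<times> UNIV)) = (\<Sum>q=1..n. \<Sum>j\<in>UNIV. f (Busy q e j))" for e n
    by (subst sum.reindex) (auto simp: inj_on_def sum.cartesian_product split_def)
  show ?thesis
    unfolding pull_states_eq
    by (subst sum.union_disjoint, force, force, force)+ (simp only: 1, simp)
qed

text \<open>Each kind of transition into a given level comes from a single row. The second
  hypothesis admits rows partly or wholly outside the state space, so the top level needs no
  separate treatment.\<close>

lemma sum_single_row:
  fixes f :: "('n::finite) pull_state \<Rightarrow> real"
  assumes "\<And>x. x \<in> pull_states m \<Longrightarrow> x \<notin> range (Busy q e) \<Longrightarrow> f x = 0"
    and "\<And>j. Busy q e j \<notin> pull_states m \<Longrightarrow> f (Busy q e j) = 0"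
  shows "(\<Sum>x\<in>pull_states m. f x) = (\<Sum>j\<in>UNIV. f (Busy q e j))"
proof -
  have "(\<Sum>x\<in>pull_states m. f x) = (\<Sum>x\<in>pull_states m \<inter> range (Busy q e). f x)"
    by (rule sum.mono_neutral_right) (use assms in auto)
  also have "\<dots> = (\<Sum>x\<in>range (Busy q e). f x)"
    by (rule sum.mono_neutral_left) (use assms(2) in \<open>auto simp del: Busy_in_pull_states\<close>)
  also have "\<dots> = (\<Sum>j\<in>UNIV. f (Busy q e j))"
    by (subst sum.reindex) (auto simp: inj_def)
  finally show ?thesis .
qed

lemma sum_single_state:
  fixes f :: "('n::finite) pull_state \<Rightarrow> real"
  assumes "y \<in> pull_states m" and "\<And>x. x \<in> pull_states m \<Longrightarrow> x \<noteq> y \<Longrightarrow> f x = 0"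
  shows "(\<Sum>x\<in>pull_states m. f x) = f y"
  using sum.mono_neutral_right[of "pull_states m" "{y}" f] assms by auto

text \<open>Row vectors over the phases make the balance equations matrix equations. For
  \<open>p\<close> supported on the state space, levels above the top are zero vectors.\<close>

definition level :: "('n pull_state \<Rightarrow> real) \<Rightarrow> nat \<Rightarrow> nat \<Rightarrow> real^'n" where
  "level p q e = (\<chi> j. p (Busy q e j))"

lemma level_nth [simp]: "level p q e $ j = p (Busy q e j)"
  by (simp add: level_def)

text \<open>The rate at which a state sends an update of either kind. Both kinds lead to the same
  place, so only the total update flow enters the balance equations.\<close>

fun reset_rate :: "real^'n^'n \<Rightarrow> real \<Rightarrow> real \<Rightarrow> 'n pull_state \<Rightarrow> real" where
  "reset_rate S \<delta>0 \<delta>1 (Idle e) = \<delta>0"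
| "reset_rate S \<delta>0 \<delta>1 (Busy q e j) = \<delta>1 * exit_rate S $ j"

text \<open>Self-transitions are excluded from the generator but counted in both sums on the right,
  where they cancel. Inflow and outflow can therefore be summed over all states without
  exceptions.\<close>

lemma sum_generator:
  assumes "y \<in> pull_states m"
  shows "(\<Sum>x\<in>pull_states m. p x * pull_generator \<alpha> S \<delta>0 \<delta>1 m \<nu> x y) =
    (\<Sum>x\<in>pull_states m. p x * pull_rate \<alpha> S \<delta>0 \<delta>1 m \<nu> x y) -
    p y * (\<Sum>z\<in>pull_states m. pull_rate \<alpha> S \<delta>0 \<delta>1 m \<nu> y z)"
proof -
  have "p x * pull_generator \<alpha> S \<delta>0 \<delta>1 m \<nu> x y = p x * pull_rate \<alpha> S \<delta>0 \<delta>1 m \<nu> x y -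
     (if x = y then p y * (\<Sum>z\<in>pull_states m. pull_rate \<alpha> S \<delta>0 \<delta>1 m \<nu> y z) else 0)" for x
    using assms by (auto simp: pull_generator_def sum.remove[of _ y] algebra_simps)
  then show ?thesis
    using assms by (simp add: sum_subtractf)
qed

lemma phase_inflow_Busy:
  fixes p :: "('n::finite) pull_state \<Rightarrow> real"
  assumes "\<forall>x. x \<notin> pull_states m \<longrightarrow> p x = 0"
  shows "(\<Sum>x\<in>pull_states m. p x * phase_rate S x (Busy q e j)) =
    (level p q e v* S) $ j - p (Busy q e j) * S $ j $ j"
proof -
  have "(\<Sum>x\<in>pull_states m. p x * phase_rate S x (Busy q e j)) =
      (\<Sum>i\<in>UNIV. p (Busy q e i) * phase_rate S (Busy q e i) (Busy q e j))"
  proof (rule sum_single_row)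
    fix x :: "'n pull_state" assume "x \<notin> range (Busy q e)"
    then show "p x * phase_rate S x (Busy q e j) = 0" by (cases x) auto
  qed (use assms in auto)
  also have "\<dots> = (\<Sum>i\<in>UNIV. p (Busy q e i) * S $ i $ j - (if i = j then p (Busy q e j) * S $ j $ j else 0))"
    by (intro sum.cong) auto
  finally show ?thesis
    by (simp add: sum_subtractf vector_matrix_mult_def)
qed

lemma silent_inflow_Busy:
  fixes p :: "('n::finite) pull_state \<Rightarrow> real"
  assumes "\<forall>x. x \<notin> pull_states m \<longrightarrow> p x = 0" and "1 \<le> q"
  shows "(\<Sum>x\<in>pull_states m. p x * silent_completion_rate \<alpha> S \<delta>1 x (Busy q e j)) =
    (1 - \<delta>1) * (level p (Suc q) e \<bullet> exit_rate S) * \<alpha> $ j"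
proof -
  have "(\<Sum>x\<in>pull_states m. p x * silent_completion_rate \<alpha> S \<delta>1 x (Busy q e j)) =
      (\<Sum>i\<in>UNIV. p (Busy (Suc q) e i) * silent_completion_rate \<alpha> S \<delta>1 (Busy (Suc q) e i) (Busy q e j))"
  proof (rule sum_single_row)
    fix x :: "'n pull_state" assume "x \<notin> range (Busy (Suc q) e)"
    then show "p x * silent_completion_rate \<alpha> S \<delta>1 x (Busy q e j) = 0" by (cases x) auto
  qed (use assms in auto)
  then show ?thesis
    using assms(2) by (simp add: inner_vec_def sum_distrib_left sum_distrib_right mult_ac)
qed

lemma silent_inflow_Idle:
  fixes p :: "('n::finite) pull_state \<Rightarrow> real"
  assumes "\<forall>x. x \<notin> pull_states m \<longrightarrow> p x = 0"
  shows "(\<Sum>x\<in>pull_states m. p x * silent_completion_rate \<alpha> S \<delta>1 x (Idle e)) =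
    (1 - \<delta>1) * (level p 1 e \<bullet> exit_rate S)"
proof -
  have "(\<Sum>x\<in>pull_states m. p x * silent_completion_rate \<alpha> S \<delta>1 x (Idle e)) =
      (\<Sum>i\<in>UNIV. p (Busy 1 e i) * silent_completion_rate \<alpha> S \<delta>1 (Busy 1 e i) (Idle e))"
  proof (rule sum_single_row)
    fix x :: "'n pull_state" assume "x \<notin> range (Busy 1 e)"
    then show "p x * silent_completion_rate \<alpha> S \<delta>1 x (Idle e) = 0" by (cases x) auto
  qed (use assms in auto)
  then show ?thesis
    by (simp add: inner_vec_def sum_distrib_left mult_ac)
qed

lemma reset_inflow_Busy:
  assumes "1 \<le> q"
  shows "(\<Sum>x\<in>pull_states m. p x * (update_completion_rate \<alpha> S \<delta>1 m x (Busy q e j) +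
      idle_update_rate \<alpha> \<delta>0 m x (Busy q e j))) =
    (if q = m \<and> e = m then (\<Sum>x\<in>pull_states m. p x * reset_rate S \<delta>0 \<delta>1 x) * \<alpha> $ j else 0)"
proof -
  have "update_completion_rate \<alpha> S \<delta>1 m x (Busy q e j) + idle_update_rate \<alpha> \<delta>0 m x (Busy q e j) =
      (if q = m \<and> e = m then reset_rate S \<delta>0 \<delta>1 x * \<alpha> $ j else 0)" for x
    using assms by (cases x) auto
  then show ?thesis
    by (auto simp: sum_distrib_left mult_ac)
qed

lemma reset_inflow_Idle:
  "(\<Sum>x\<in>pull_states m. p x * (update_completion_rate \<alpha> S \<delta>1 m x (Idle e) +
      idle_update_rate \<alpha> \<delta>0 m x (Idle e))) =
    (if m = 0 \<and> e = 0 then (\<Sum>x\<in>pull_states m. p x * reset_rate S \<delta>0 \<delta>1 x) else 0)"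
proof -
  have "update_completion_rate \<alpha> S \<delta>1 m x (Idle e) + idle_update_rate \<alpha> \<delta>0 m x (Idle e) =
      (if m = 0 \<and> e = 0 then reset_rate S \<delta>0 \<delta>1 x else 0)" for x
    by (cases x) auto
  then show ?thesis
    by simp
qed

lemma assignment_inflow_Busy:
  fixes p :: "('n::finite) pull_state \<Rightarrow> real"
  assumes "\<forall>x. x \<notin> pull_states m \<longrightarrow> p x = 0" and "1 \<le> q"
  shows "(\<Sum>x\<in>pull_states m. p x * assignment_rate \<alpha> m \<nu> x (Busy q e j)) =
    (if e = Suc m then \<nu> * (if q = 1 then p (Idle m) *\<^sub>R \<alpha> else level p (q - 1) m) $ j else 0)"
proof (cases "e = Suc m")
  case False
  then have "assignment_rate \<alpha> m \<nu> x (Busy q e j) = 0" for x by (cases x) auto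
  with False show ?thesis by simp
next
  case e: True
  show ?thesis
  proof (cases "q = 1")
    case True
    have "(\<Sum>x\<in>pull_states m. p x * assignment_rate \<alpha> m \<nu> x (Busy q e j)) =
        p (Idle m) * assignment_rate \<alpha> m \<nu> (Idle m) (Busy q e j)"
    proof (rule sum_single_state)
      fix x :: "'n pull_state" assume "x \<in> pull_states m" "x \<noteq> Idle m"
      then show "p x * assignment_rate \<alpha> m \<nu> x (Busy q e j) = 0"
        using True by (cases x) auto
    qed simp
    with True e show ?thesis by simp
  next
    case False
    have "(\<Sum>x\<in>pull_states m. p x * assignment_rate \<alpha> m \<nu> x (Busy q e j)) =
        (\<Sum>i\<in>UNIV. p (Busy (q - 1) m i) * assignment_rate \<alpha> m \<nu> (Busy (q - 1) m i) (Busy q e j))"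
    proof (rule sum_single_row)
      fix x :: "'n pull_state" assume "x \<notin> range (Busy (q - 1) m)"
      then show "p x * assignment_rate \<alpha> m \<nu> x (Busy q e j) = 0"
        using False by (cases x) auto
    qed (use assms in auto)
    also have "\<dots> = (\<Sum>i\<in>UNIV. if i = j then p (Busy (q - 1) m i) * \<nu> else 0)"
      using False e \<open>1 \<le> q\<close> by (intro sum.cong) auto
    finally show ?thesis using e False by simp
  qed
qed

lemma assignment_inflow_Idle: "assignment_rate \<alpha> m \<nu> x (Idle e) = 0"
  and phase_inflow_Idle: "phase_rate S x (Idle e) = 0"
  by (cases x; simp)+

lemma outflow_Idle:
  fixes \<alpha> :: "real^'n"
  assumes \<alpha>: "(\<Sum>i\<in>UNIV. \<alpha> $ i) = 1" and e: "e = m \<or> e = Suc m"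
  shows "(\<Sum>z\<in>(pull_states m :: 'n pull_state set). pull_rate \<alpha> S \<delta>0 \<delta>1 m \<nu> (Idle e) z) = \<delta>0 + (if e = m then \<nu> else 0)"
proof -
  have "(\<Sum>z\<in>(pull_states m :: 'n pull_state set). idle_update_rate \<alpha> \<delta>0 m (Idle e) z) = \<delta>0"
  proof (cases "m = 0")
    case True
    have "(\<Sum>z\<in>(pull_states m :: 'n pull_state set). idle_update_rate \<alpha> \<delta>0 m (Idle e) z) =
        idle_update_rate \<alpha> \<delta>0 m (Idle e) (Idle m)"
    proof (rule sum_single_state)
      fix x :: "'n pull_state" assume "x \<in> pull_states m" "x \<noteq> Idle m"
      then show "idle_update_rate \<alpha> \<delta>0 m (Idle e) x = 0"
        using True by (cases x) auto
    qed simp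
    with True show ?thesis by simp
  next
    case False
    have "(\<Sum>z\<in>(pull_states m :: 'n pull_state set). idle_update_rate \<alpha> \<delta>0 m (Idle e) z) =
        (\<Sum>i\<in>UNIV. idle_update_rate \<alpha> \<delta>0 m (Idle e) (Busy m m i))"
    proof (rule sum_single_row)
      fix x :: "'n pull_state" assume "x \<notin> range (Busy m m)"
      then show "idle_update_rate \<alpha> \<delta>0 m (Idle e) x = 0"
        using False by (cases x) auto
    qed (use False in auto)
    with False \<alpha> show ?thesis by (simp flip: sum_distrib_left)
  qed
  moreover have "(\<Sum>z\<in>(pull_states m :: 'n pull_state set). assignment_rate \<alpha> m \<nu> (Idle e) z) =
      (\<Sum>i\<in>UNIV. assignment_rate \<alpha> m \<nu> (Idle e) (Busy 1 (Suc m) i))"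
  proof (rule sum_single_row)
    fix x :: "'n pull_state" assume "x \<notin> range (Busy 1 (Suc m))"
    then show "assignment_rate \<alpha> m \<nu> (Idle e) x = 0"
      by (cases x) auto
  qed auto
  ultimately show ?thesis
    using \<alpha> by (auto simp: pull_rate_def sum.distrib simp flip: sum_distrib_left)
qed

text \<open>The row sum of \<open>S\<close> is minus the exit rate, so the total rate of phase
  changes is \<open>- exit_rate S $ j - S $ j $ j\<close>. The two kinds of completion together add
  back exactly the exit rate.\<close>

lemma outflow_Busy:
  fixes \<alpha> :: "real^'n"
  assumes \<alpha>: "(\<Sum>i\<in>UNIV. \<alpha> $ i) = 1" and y: "Busy q e j \<in> (pull_states m :: 'n pull_state set)"
  shows "(\<Sum>z\<in>(pull_states m :: 'n pull_state set). pull_rate \<alpha> S \<delta>0 \<delta>1 m \<nu> (Busy q e j) z) =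
    (if e = m then \<nu> else 0) - S $ j $ j"
proof -
  have "(\<Sum>z\<in>(pull_states m :: 'n pull_state set). phase_rate S (Busy q e j) z) =
      (\<Sum>i\<in>UNIV. phase_rate S (Busy q e j) (Busy q e i))"
  proof (rule sum_single_row)
    fix x :: "'n pull_state" assume "x \<notin> range (Busy q e)"
    then show "phase_rate S (Busy q e j) x = 0" by (cases x) auto
  qed (use y in auto)
  also have "\<dots> = (\<Sum>i\<in>UNIV. S $ j $ i - (if i = j then S $ j $ j else 0))"
    by (intro sum.cong) auto
  finally have 1: "(\<Sum>z\<in>(pull_states m :: 'n pull_state set). phase_rate S (Busy q e j) z) = - exit_rate S $ j - S $ j $ j"
    by (simp add: sum_subtractf exit_rate_def matrix_vector_mult_def)
  have 2: "(\<Sum>z\<in>(pull_states m :: 'n pull_state set). silent_completion_rate \<alpha> S \<delta>1 (Busy q e j) z) = (1 - \<delta>1) * exit_rate S $ j"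
  proof (cases "q = 1")
    case True
    have "(\<Sum>z\<in>(pull_states m :: 'n pull_state set). silent_completion_rate \<alpha> S \<delta>1 (Busy q e j) z) =
        silent_completion_rate \<alpha> S \<delta>1 (Busy q e j) (Idle e)"
    proof (rule sum_single_state)
      fix x :: "'n pull_state" assume "x \<noteq> Idle e"
      then show "silent_completion_rate \<alpha> S \<delta>1 (Busy q e j) x = 0"
        using True by (cases x) auto
    qed (use y in auto)
    with True show ?thesis by simp
  next
    case False
    have "(\<Sum>z\<in>(pull_states m :: 'n pull_state set). silent_completion_rate \<alpha> S \<delta>1 (Busy q e j) z) =
        (\<Sum>i\<in>UNIV. silent_completion_rate \<alpha> S \<delta>1 (Busy q e j) (Busy (q - 1) e i))"
    proof (rule sum_single_row)
      fix x :: "'n pull_state" assume "x \<notin> range (Busy (q - 1) e)"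
      then show "silent_completion_rate \<alpha> S \<delta>1 (Busy q e j) x = 0"
        using False by (cases x) auto
    qed (use y False in auto)
    with False y \<alpha> show ?thesis by (simp flip: sum_distrib_left)
  qed
  have 3: "(\<Sum>z\<in>(pull_states m :: 'n pull_state set). update_completion_rate \<alpha> S \<delta>1 m (Busy q e j) z) = \<delta>1 * exit_rate S $ j"
  proof (cases "m = 0")
    case True
    have "(\<Sum>z\<in>(pull_states m :: 'n pull_state set). update_completion_rate \<alpha> S \<delta>1 m (Busy q e j) z) =
        update_completion_rate \<alpha> S \<delta>1 m (Busy q e j) (Idle m)"
    proof (rule sum_single_state)
      fix x :: "'n pull_state" assume "x \<noteq> Idle m"
      then show "update_completion_rate \<alpha> S \<delta>1 m (Busy q e j) x = 0"
        using True by (cases x) auto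
    qed auto
    with True show ?thesis by simp
  next
    case False
    have "(\<Sum>z\<in>(pull_states m :: 'n pull_state set). update_completion_rate \<alpha> S \<delta>1 m (Busy q e j) z) =
        (\<Sum>i\<in>UNIV. update_completion_rate \<alpha> S \<delta>1 m (Busy q e j) (Busy m m i))"
    proof (rule sum_single_row)
      fix x :: "'n pull_state" assume "x \<notin> range (Busy m m)"
      then show "update_completion_rate \<alpha> S \<delta>1 m (Busy q e j) x = 0"
        using False by (cases x) auto
    qed (use False in auto)
    with False \<alpha> show ?thesis by (simp flip: sum_distrib_left)
  qed
  have 4: "(\<Sum>z\<in>(pull_states m :: 'n pull_state set). assignment_rate \<alpha> m \<nu> (Busy q e j) z) = (if e = m then \<nu> else 0)"
  proof (cases "e = m")
    case True
    have "(\<Sum>z\<in>(pull_states m :: 'n pull_state set). assignment_rate \<alpha> m \<nu> (Busy q e j) z) =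
        assignment_rate \<alpha> m \<nu> (Busy q e j) (Busy (Suc q) (Suc m) j)"
    proof (rule sum_single_state)
      fix x :: "'n pull_state" assume "x \<noteq> Busy (Suc q) (Suc m) j"
      then show "assignment_rate \<alpha> m \<nu> (Busy q e j) x = 0"
        by (cases x) auto
    qed (use y True in auto)
    with True show ?thesis by simp
  next
    case False
    then have "assignment_rate \<alpha> m \<nu> (Busy q e j) x = 0" for x by (cases x) auto
    with False show ?thesis by simp
  qed
  have 5: "idle_update_rate \<alpha> \<delta>0 m (Busy q e j) z = 0" for z by simp
  show ?thesis
    unfolding pull_rate_def sum.distrib 1 2 3 4 5 by (simp add: algebra_simps)
qed

section \<open>The stationary distribution\<close>

lemma shift_mult_row: "x v* (mat k - A) = k *\<^sub>R x - x v* A" for A :: "real^'n^'n"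
proof -
  have "mat k = k *\<^sub>R (mat 1 :: real^'n^'n)"
    by (simp add: vec_eq_iff mat_def)
  then have "x v* mat k = k *\<^sub>R x"
    by (simp only: vector_scaleR_matrix_ac vector_matrix_mul_rid)
  then show ?thesis by (simp add: vector_matrix_mult_diff_rdistrib)
qed

locale pull_chain = phase_type_dist \<alpha> S for \<alpha> :: "real^'n" and S :: "real^'n^'n" +
  fixes \<delta>0 \<delta>1 \<nu> :: real and m :: nat
  assumes \<delta>1: "0 < \<delta>1" "\<delta>1 < 1" and \<delta>0: "0 < \<delta>0" and \<nu>: "0 \<le> \<nu>"
begin

definition r :: real where "r = 1 - \<delta>1"
lemma r_bounds: "0 < r" "r < 1"
  using \<delta>1 by (auto simp: r_def)

abbreviation states :: "'n pull_state set" where "states \<equiv> pull_states m"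

definition reset_flow :: "('n pull_state \<Rightarrow> real) \<Rightarrow> real" where
  "reset_flow p = (\<Sum>x\<in>states. p x * reset_rate S \<delta>0 \<delta>1 x)"

text \<open>The balance equations, solved for the phase distribution of each level, in which the flow \<open>c\<close>
  of updates is a free parameter; a stationary distribution has \<open>c = reset_flow p\<close>.\<close>

definition balanced :: "real \<Rightarrow> ('n pull_state \<Rightarrow> real) \<Rightarrow> bool" where
  "balanced c p \<longleftrightarrow> (\<forall>x. x \<notin> states \<longrightarrow> p x = 0) \<and>
    (\<delta>0 + \<nu>) * p (Idle m) = r * (level p 1 m \<bullet> s) + (if m = 0 then c else 0) \<and>
    \<delta>0 * p (Idle (Suc m)) = r * (level p 1 (Suc m) \<bullet> s) \<and>
    (\<forall>q\<in>{1..m}. level p q m = (r * (level p (Suc q) m \<bullet> s) + (if q = m then c else 0)) *\<^sub>R (\<alpha> v* K \<nu>)) \<and>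
    (\<forall>q\<in>{1..Suc m}. level p q (Suc m) = ((r * (level p (Suc q) (Suc m) \<bullet> s)) *\<^sub>R \<alpha> +
       \<nu> *\<^sub>R (if q = 1 then p (Idle m) *\<^sub>R \<alpha> else level p (q - 1) m)) v* K 0)"

lemma net_flow_Idle:
  assumes supp: "\<forall>x. x \<notin> states \<longrightarrow> p x = 0" and e: "e = m \<or> e = Suc m"
  shows "(\<Sum>x\<in>states. p x * pull_generator \<alpha> S \<delta>0 \<delta>1 m \<nu> x (Idle e)) =
    r * (level p 1 e \<bullet> s) + (if m = 0 \<and> e = 0 then reset_flow p else 0) -
    (\<delta>0 + (if e = m then \<nu> else 0)) * p (Idle e)"
proof -
  have *: "(\<Sum>x\<in>states. p x * pull_rate \<alpha> S \<delta>0 \<delta>1 m \<nu> x (Idle e)) =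
      (\<Sum>x\<in>states. p x * silent_completion_rate \<alpha> S \<delta>1 x (Idle e)) +
      (\<Sum>x\<in>states. p x * (update_completion_rate \<alpha> S \<delta>1 m x (Idle e) +
        idle_update_rate \<alpha> \<delta>0 m x (Idle e)))"
    by (simp add: pull_rate_def assignment_inflow_Idle phase_inflow_Idle algebra_simps flip: sum.distrib)
  have y: "Idle e \<in> states" using e by simp
  show ?thesis
    unfolding sum_generator[OF y] * outflow_Idle[OF alpha(2) e] silent_inflow_Idle[OF supp]
      reset_inflow_Idle reset_flow_def[symmetric] r_def[symmetric] by simp
qed

lemma net_flow_Busy:
  assumes supp: "\<forall>x. x \<notin> states \<longrightarrow> p x = 0" and y: "Busy q e j \<in> states"
  shows "(\<Sum>x\<in>states. p x * pull_generator \<alpha> S \<delta>0 \<delta>1 m \<nu> x (Busy q e j)) =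
    ((r * (level p (Suc q) e \<bullet> s) + (if q = m \<and> e = m then reset_flow p else 0)) *\<^sub>R \<alpha> +
     (if e = Suc m then \<nu> *\<^sub>R (if q = 1 then p (Idle m) *\<^sub>R \<alpha> else level p (q - 1) m) else 0) -
     level p q e v* (mat (if e = m then \<nu> else 0) - S)) $ j"
proof -
  have q: "1 \<le> q" using y by simp
  have *: "(\<Sum>x\<in>states. p x * pull_rate \<alpha> S \<delta>0 \<delta>1 m \<nu> x (Busy q e j)) =
      (\<Sum>x\<in>states. p x * phase_rate S x (Busy q e j)) +
      (\<Sum>x\<in>states. p x * silent_completion_rate \<alpha> S \<delta>1 x (Busy q e j)) +
      (\<Sum>x\<in>states. p x * (update_completion_rate \<alpha> S \<delta>1 m x (Busy q e j) +
        idle_update_rate \<alpha> \<delta>0 m x (Busy q e j))) +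
      (\<Sum>x\<in>states. p x * assignment_rate \<alpha> m \<nu> x (Busy q e j))"
    by (simp add: pull_rate_def algebra_simps flip: sum.distrib)
  show ?thesis
    unfolding sum_generator[OF y] * outflow_Busy[OF alpha(2) y] phase_inflow_Busy[OF supp]
      silent_inflow_Busy[OF supp q] reset_inflow_Busy[OF q] assignment_inflow_Busy[OF supp q]
      shift_mult_row reset_flow_def[symmetric] r_def[symmetric]
    by (simp add: algebra_simps)
qed

text \<open>Busy states with estimate \<open>m\<close> are left by assignment at rate \<nu>, which
  yields the resolvent \<open>K \<nu>\<close>; states with estimate \<open>m + 1\<close> receive no
  assignments, which yields \<open>K 0\<close>. \<open>K_solve\<close> then inverts the equations
  level by level.\<close>

lemma is_stationary_iff:
  "is_stationary \<alpha> S \<delta>0 \<delta>1 m \<nu> p \<longleftrightarrow>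
    (\<forall>x\<in>states. 0 \<le> p x) \<and> (\<Sum>x\<in>states. p x) = 1 \<and> balanced (reset_flow p) p"
proof (cases "\<forall>x. x \<notin> states \<longrightarrow> p x = 0")
  case False
  then show ?thesis by (auto simp: is_stationary_def balanced_def)
next
  case supp: True
  let ?G = "\<lambda>y. \<Sum>x\<in>states. p x * pull_generator \<alpha> S \<delta>0 \<delta>1 m \<nu> x y"
  have all: "(\<forall>y\<in>states. ?G y = 0) \<longleftrightarrow> ?G (Idle m) = 0 \<and> ?G (Idle (Suc m)) = 0 \<and>
      (\<forall>q\<in>{1..m}. \<forall>j. ?G (Busy q m j) = 0) \<and> (\<forall>q\<in>{1..Suc m}. \<forall>j. ?G (Busy q (Suc m) j) = 0)"
    unfolding pull_states_eq by (simp add: ball_Un split_def)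
  have 1: "?G (Idle m) = 0 \<longleftrightarrow> (\<delta>0 + \<nu>) * p (Idle m) = r * (level p 1 m \<bullet> s) + (if m = 0 then reset_flow p else 0)"
    using net_flow_Idle[OF supp, of m] by auto
  have 2: "?G (Idle (Suc m)) = 0 \<longleftrightarrow> \<delta>0 * p (Idle (Suc m)) = r * (level p 1 (Suc m) \<bullet> s)"
    using net_flow_Idle[OF supp, of "Suc m"] by auto
  have 3: "(\<forall>j. ?G (Busy q m j) = 0) \<longleftrightarrow>
      level p q m = (r * (level p (Suc q) m \<bullet> s) + (if q = m then reset_flow p else 0)) *\<^sub>R (\<alpha> v* K \<nu>)"
    (is "_ \<longleftrightarrow> ?R") if "q \<in> {1..m}" for q
  proof -
    have "(\<forall>j. ?G (Busy q m j) = 0) \<longleftrightarrow>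
        level p q m v* (mat \<nu> - S) = (r * (level p (Suc q) m \<bullet> s) + (if q = m then reset_flow p else 0)) *\<^sub>R \<alpha>"
      using that net_flow_Busy[OF supp, of q m] by (auto simp: vec_eq_iff)
    also have "\<dots> \<longleftrightarrow> ?R"
      unfolding K_solve[OF \<nu>] scaleR_vector_matrix_assoc ..
    finally show ?thesis .
  qed
  have 4: "(\<forall>j. ?G (Busy q (Suc m) j) = 0) \<longleftrightarrow>
      level p q (Suc m) = ((r * (level p (Suc q) (Suc m) \<bullet> s)) *\<^sub>R \<alpha> +
       \<nu> *\<^sub>R (if q = 1 then p (Idle m) *\<^sub>R \<alpha> else level p (q - 1) m)) v* K 0"
    (is "_ \<longleftrightarrow> ?R") if "q \<in> {1..Suc m}" for q
  proof -
    have "(\<forall>j. ?G (Busy q (Suc m) j) = 0) \<longleftrightarrow>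
        level p q (Suc m) v* (mat 0 - S) = (r * (level p (Suc q) (Suc m) \<bullet> s)) *\<^sub>R \<alpha> +
       \<nu> *\<^sub>R (if q = 1 then p (Idle m) *\<^sub>R \<alpha> else level p (q - 1) m)"
      using that net_flow_Busy[OF supp, of q "Suc m"] by (auto simp: vec_eq_iff)
    also have "\<dots> \<longleftrightarrow> ?R"
      by (rule K_solve) simp
    finally show ?thesis .
  qed
  show ?thesis
    using supp all 1 2 3 4 unfolding is_stationary_def balanced_def by simp
qed

section \<open>The explicit solution for unit update flow\<close>

abbreviation L :: real where "L \<equiv> lst \<nu>"

text \<open>The mass of \<open>Idle m\<close> per unit of update flow, not yet normalised. After an
  update, \<open>m\<close> jobs in a row must finish silently and before an assignment, each with
  probability \<open>r * L\<close>; the mean stay is then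
  \<open>1 / (\<delta>0 + \<nu>)\<close>.\<close>

definition idle_prob :: real where "idle_prob = (r * L) ^ m / (\<delta>0 + \<nu>)"

text \<open>The power is the probability of \<open>m - q\<close> silent completions before any
  assignment, and \<open>\<alpha> v* K \<nu>\<close> is the mean time spent in each phase by the
  next job until it finishes or an assignment occurs.\<close>

definition low_row :: "nat \<Rightarrow> real^'n" where
  "low_row q = (if 1 \<le> q \<and> q \<le> m then (r * L) ^ (m - q) *\<^sub>R (\<alpha> v* K \<nu>) else 0)"

text \<open>The first summand accounts for jobs started at this level: \<open>Suc m - q\<close>
  silent completions, with an assignment during one of those jobs. The second accounts for
  assignments from queue length \<open>q - 1\<close>, where a job in service keeps its phase and an
  idle server draws one from \<alpha>.\<close>

definition high_row :: "nat \<Rightarrow> real^'n" where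
  "high_row q = (if 1 \<le> q \<and> q \<le> Suc m then
     (r ^ (Suc m - q) * (1 - L ^ (Suc m - q))) *\<^sub>R (\<alpha> v* K 0) +
     \<nu> *\<^sub>R ((if q = 1 then idle_prob *\<^sub>R \<alpha> else low_row (q - 1)) v* K 0) else 0)"

fun sol :: "'n pull_state \<Rightarrow> real" where
  "sol (Idle e) = (if e = m then idle_prob
     else if e = Suc m then r * (high_row 1 \<bullet> s) / \<delta>0 else 0)"
| "sol (Busy q e j) = (if e = m then low_row q $ j else if e = Suc m then high_row q $ j else 0)"

lemma level_sol [simp]: "level sol q m = low_row q" "level sol q (Suc m) = high_row q"
  by (simp_all add: vec_eq_iff)

lemma L_bounds: "0 < L" "L \<le> 1"
  using lst_pos lst_le_1 \<nu> by auto

lemma idle_prob_pos: "0 < idle_prob"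
  using L_bounds \<delta>0 r_bounds \<nu> by (simp add: idle_prob_def)

lemma low_row_nonneg: "0 \<le> low_row q $ j"
  using L_bounds r_bounds \<nu> by (simp add: low_row_def row_K_nonneg alpha)

lemma high_row_nonneg: "0 \<le> high_row q $ j"
proof -
  have "0 \<le> ((if q = 1 then idle_prob *\<^sub>R \<alpha> else low_row (q - 1)) v* K 0) $ j"
    by (rule row_K_nonneg) (use idle_prob_pos low_row_nonneg alpha in auto)
  then show ?thesis
    using L_bounds r_bounds \<nu> by (simp add: high_row_def row_K_nonneg alpha power_le_one)
qed

lemma sol_nonneg: "0 \<le> sol x"
  using idle_prob_pos low_row_nonneg high_row_nonneg exit_rate_nonneg \<delta>0 r_bounds
  by (cases x) (auto intro!: mult_nonneg_nonneg divide_nonneg_pos inner_nonneg)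

lemma low_row_inner: "1 \<le> q \<Longrightarrow> q \<le> m \<Longrightarrow> low_row q \<bullet> w = (r * L) ^ (m - q) * (\<alpha> \<bullet> (K \<nu> *v w))"
  by (simp add: low_row_def dot_lmul_matrix)

text \<open>Both \<open>w = 1\<close> (mass) and \<open>w = s\<close> (completion flow) satisfy the hypothesis, so the busy
  probability equals the completion rate.\<close>

lemma low_high_inner:
  assumes "\<alpha> \<bullet> (K 0 *v w) = 1" and "1 \<le> q" "q \<le> m"
  shows "low_row q \<bullet> w + high_row (Suc q) \<bullet> w = r ^ (m - q)"
proof -
  \<comment> \<open>What assignments remove from a low row reappears in the next high row, so the
    sum of the two no longer depends on \<nu>.\<close>
  have "\<nu> * (\<alpha> \<bullet> (K \<nu> *v (K 0 *v w))) = 1 - \<alpha> \<bullet> (K \<nu> *v w)"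
    using arg_cong[OF resolvent_identity[of \<nu> 0 w], of "(\<bullet>) \<alpha>"] \<nu> assms(1)
    by (simp add: inner_diff_right)
  then have "\<nu> * (low_row q \<bullet> (K 0 *v w)) = (r * L) ^ (m - q) * (1 - \<alpha> \<bullet> (K \<nu> *v w))"
    using assms by (simp add: low_row_inner)
  then show ?thesis
    using assms
    by (simp add: high_row_def low_row_inner inner_add_left dot_lmul_matrix power_mult_distrib algebra_simps)
qed

lemma high_row_1_inner:
  assumes "\<alpha> \<bullet> (K 0 *v w) = 1"
  shows "high_row 1 \<bullet> w = r ^ m * (1 - L ^ m) + \<nu> * idle_prob"
  using assms by (simp add: high_row_def inner_add_left dot_lmul_matrix scaleR_vector_matrix_assoc)

text \<open>The silent completion flow into level \<open>q\<close> is the first coefficient of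
  \<open>high_row q\<close>, which closes the recursion. At \<open>q = Suc m\<close> both sides
  vanish.\<close>

lemma high_row_Suc_exit:
  assumes "1 \<le> q" "q \<le> Suc m"
  shows "r * (high_row (Suc q) \<bullet> s) = r ^ (Suc m - q) * (1 - L ^ (Suc m - q))"
proof (cases "q = Suc m")
  case True
  then show ?thesis by (simp add: high_row_def)
next
  case False
  then have q: "1 \<le> q" "q \<le> m" using assms by auto
  have *: "high_row (Suc q) \<bullet> s = r ^ (m - q) - (r * L) ^ (m - q) * L"
    using low_high_inner[OF alpha_K0(2) q] low_row_inner[OF q, of s] by (simp add: lst_def)
  show ?thesis
    using q unfolding * by (simp add: Suc_diff_le power_mult_distrib algebra_simps)
qed

lemma balanced_sol: "balanced 1 sol"
  unfolding balanced_def
proof (intro conjI ballI allI impI)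
  fix x :: "'n pull_state" assume "x \<notin> states"
  then show "sol x = 0" by (cases x) (auto simp: low_row_def high_row_def)
next
  show "(\<delta>0 + \<nu>) * sol (Idle m) = r * (level sol 1 m \<bullet> s) + (if m = 0 then 1 else 0)"
  proof -
    \<comment> \<open>For \<open>m = 0\<close> there is no low row, and the unit update flow enters
      \<open>Idle 0\<close> directly.\<close>
    have "(r * L) ^ m = r * (low_row 1 \<bullet> s) + (if m = 0 then 1 else 0)"
    proof (cases "m = 0")
      case False
      then show ?thesis
        using power_minus_mult[of m "r * L"] by (simp add: low_row_inner lst_def mult_ac)
    next
      case True
      then have "low_row 1 = 0" unfolding low_row_def by simp
      with True show ?thesis by simp
    qed
    with \<delta>0 \<nu> show ?thesis by (simp add: idle_prob_def)
  qed
next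
  show "\<delta>0 * sol (Idle (Suc m)) = r * (level sol 1 (Suc m) \<bullet> s)"
    using \<delta>0 by simp
next
  fix q assume q: "q \<in> {1..m}"
  have "(r * L) ^ (m - q) = r * (low_row (Suc q) \<bullet> s) + (if q = m then 1 else 0)"
  proof (cases "q = m")
    case True
    then show ?thesis by (simp add: low_row_def)
  next
    case False
    then have "m - q = Suc (m - Suc q)" using q by auto
    with False q show ?thesis by (simp add: low_row_inner lst_def)
  qed
  with q show "level sol q m = (r * (level sol (Suc q) m \<bullet> s) + (if q = m then 1 else 0)) *\<^sub>R (\<alpha> v* K \<nu>)"
    by (simp add: low_row_def[of q])
next
  fix q assume "q \<in> {1..Suc m}"
  then show "level sol q (Suc m) = ((r * (level sol (Suc q) (Suc m) \<bullet> s)) *\<^sub>R \<alpha> +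
       \<nu> *\<^sub>R (if q = 1 then sol (Idle m) *\<^sub>R \<alpha> else level sol (q - 1) m)) v* K 0"
    by (simp add: high_row_Suc_exit vector_matrix_left_distrib scaleR_vector_matrix_assoc high_row_def[of q])
qed

text \<open>The system is triangular: low rows from the top down, then \<open>Idle m\<close>, then
  the high rows fed by both, then \<open>Idle (Suc m)\<close>. Each step is linear in the data
  already found, so \<open>c\<close> factors out; no sign condition on \<open>p\<close>
  enters.\<close>

lemma balanced_unique:
  assumes p: "balanced c p"
  shows "p x = c * sol x"
proof -
  note sol = balanced_sol
  have supp: "p x = 0" "sol x = 0" if "x \<notin> states" for x
    using p sol that by (auto simp: balanced_def)
  \<comment> \<open>The range includes the empty level \<open>Suc m\<close>, which serves as the
    base of the downward induction.\<close>
  have low: "level p q m = c *\<^sub>R low_row q" if "1 \<le> q" "q \<le> Suc m" for q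
    using that(2,1)
  proof (induction rule: inc_induct)
    case base
    show ?case by (simp add: vec_eq_iff low_row_def supp)
  next
    case (step q)
    have "level p q m = (r * (level p (Suc q) m \<bullet> s) + (if q = m then c else 0)) *\<^sub>R (\<alpha> v* K \<nu>)"
      using p step by (auto simp: balanced_def)
    moreover have "low_row q = (r * (low_row (Suc q) \<bullet> s) + (if q = m then 1 else 0)) *\<^sub>R (\<alpha> v* K \<nu>)"
      using sol step by (auto simp: balanced_def)
    moreover have "r * (level p (Suc q) m \<bullet> s) + (if q = m then c else 0) =
        c * (r * (low_row (Suc q) \<bullet> s) + (if q = m then 1 else 0))"
      using step by (simp add: algebra_simps)
    ultimately show ?case
      by (metis scaleR_scaleR)
  qed
  have "level p 1 m = c *\<^sub>R low_row 1" by (rule low) auto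
  moreover have "(\<delta>0 + \<nu>) * p (Idle m) = r * (level p 1 m \<bullet> s) + (if m = 0 then c else 0)"
    using p by (simp add: balanced_def)
  moreover have "(\<delta>0 + \<nu>) * sol (Idle m) = r * (low_row 1 \<bullet> s) + (if m = 0 then 1 else 0)"
    using sol by (simp add: balanced_def)
  ultimately have "(\<delta>0 + \<nu>) * p (Idle m) = (\<delta>0 + \<nu>) * (c * sol (Idle m))"
    by (simp add: algebra_simps)
  then have idle: "p (Idle m) = c * sol (Idle m)"
    using \<delta>0 \<nu> by (metis add_pos_nonneg less_irrefl mult_cancel_left)
  have high: "level p q (Suc m) = c *\<^sub>R high_row q" if "1 \<le> q" "q \<le> Suc (Suc m)" for q
    using that(2,1)
  proof (induction rule: inc_induct)
    case base
    show ?case by (simp add: vec_eq_iff high_row_def supp)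
  next
    case (step q)
    have "level p q (Suc m) = ((r * (level p (Suc q) (Suc m) \<bullet> s)) *\<^sub>R \<alpha> +
        \<nu> *\<^sub>R (if q = 1 then p (Idle m) *\<^sub>R \<alpha> else level p (q - 1) m)) v* K 0"
      using p step by (auto simp: balanced_def)
    also have "\<dots> = (c *\<^sub>R ((r * (high_row (Suc q) \<bullet> s)) *\<^sub>R \<alpha> +
        \<nu> *\<^sub>R (if q = 1 then sol (Idle m) *\<^sub>R \<alpha> else low_row (q - 1)))) v* K 0"
      using step low[of "q - 1"] by (auto simp: algebra_simps idle simp del: sol.simps)
    also have "\<dots> = c *\<^sub>R high_row q"
      using sol step unfolding scaleR_vector_matrix_assoc by (auto simp: balanced_def)
    finally show ?case .
  qed
  have "level p 1 (Suc m) = c *\<^sub>R high_row 1" by (rule high) auto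
  moreover have "\<delta>0 * p (Idle (Suc m)) = r * (level p 1 (Suc m) \<bullet> s)"
    using p by (simp add: balanced_def)
  ultimately have idle': "p (Idle (Suc m)) = c * sol (Idle (Suc m))"
    using \<delta>0 by (simp add: field_simps)
  show ?thesis
  proof (cases "x \<in> states")
    case False
    then show ?thesis by (simp add: supp)
  next
    case True
    show ?thesis
    proof (cases x)
      case (Idle e)
      then show ?thesis using True idle idle' by auto
    next
      case (Busy q e j)
      then show ?thesis
        using True low[of q] high[of q] by (auto simp: vec_eq_iff)
    qed
  qed
qed

end

section \<open>The idle probability\<close>

context phase_type_dist
begin

text \<open>The fraction of updates sent by an idle server.\<close>

definition rho :: "real \<Rightarrow> real \<Rightarrow> nat \<Rightarrow> real \<Rightarrow> real" where
  "rho \<delta>0 \<delta>1 m \<nu> = (1 - \<delta>1) ^ m * (1 - \<delta>1 + \<delta>1 * (lst \<nu> ^ m * (\<delta>0 / (\<delta>0 + \<nu>))))"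

context
  fixes \<delta>0 \<delta>1 :: real
  assumes \<delta>1: "0 < \<delta>1" "\<delta>1 < 1" and \<delta>0: "0 < \<delta>0"
begin

lemma rho_0: "rho \<delta>0 \<delta>1 m 0 = (1 - \<delta>1) ^ m"
  using \<delta>0 by (simp add: rho_def lst_0)

text \<open>Strictness comes from the factor \<open>\<delta>0 / (\<delta>0 + \<nu>)\<close>; for the
  power of \<open>lst\<close> weak monotonicity suffices, which also covers
  \<open>m = 0\<close>.\<close>

lemma rho_strict_antimono:
  assumes "0 \<le> \<mu>" "\<mu> < \<nu>"
  shows "rho \<delta>0 \<delta>1 m \<nu> < rho \<delta>0 \<delta>1 m \<mu>"
proof -
  have "lst \<nu> ^ m * (\<delta>0 / (\<delta>0 + \<nu>)) < lst \<mu> ^ m * (\<delta>0 / (\<delta>0 + \<mu>))"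
  proof (rule mult_le_less_imp_less)
    show "lst \<nu> ^ m \<le> lst \<mu> ^ m"
      using assms lst_antimono[of \<mu> \<nu>] lst_pos[of \<nu>] by (intro power_mono) auto
    show "\<delta>0 / (\<delta>0 + \<nu>) < \<delta>0 / (\<delta>0 + \<mu>)"
      using assms \<delta>0 by (intro divide_strict_left_mono) auto
    show "0 < lst \<nu> ^ m"
      using assms lst_pos[of \<nu>] by simp
    show "0 \<le> \<delta>0 / (\<delta>0 + \<nu>)"
      using assms \<delta>0 by simp
  qed
  then show ?thesis
    unfolding rho_def using \<delta>1 by (intro mult_strict_left_mono add_strict_left_mono) auto
qed

text \<open>Together with \<open>rho_le\<close> this confines \<open>rho\<close> for each
  \<open>m\<close> to a half-open interval between consecutive powers of
  \<open>1 - \<delta>1\<close>. These intervals are disjoint, so a value of \<open>rho\<close>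
  determines \<open>m\<close>.\<close>

lemma rho_gt:
  assumes "0 \<le> \<nu>"
  shows "(1 - \<delta>1) ^ Suc m < rho \<delta>0 \<delta>1 m \<nu>"
proof -
  have "0 < \<delta>1 * (lst \<nu> ^ m * (\<delta>0 / (\<delta>0 + \<nu>)))"
    using assms \<delta>0 \<delta>1 lst_pos[of \<nu>] by (intro mult_pos_pos) auto
  then have "(1 - \<delta>1) ^ m * (1 - \<delta>1) < rho \<delta>0 \<delta>1 m \<nu>"
    unfolding rho_def using \<delta>1 by (intro mult_strict_left_mono zero_less_power) linarith+
  then show ?thesis by (simp add: mult.commute)
qed

lemma rho_le: "0 \<le> \<nu> \<Longrightarrow> rho \<delta>0 \<delta>1 m \<nu> \<le> (1 - \<delta>1) ^ m"
  using rho_strict_antimono[of 0 \<nu> m] by (cases "\<nu> = 0") (auto simp: rho_0)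

lemma continuous_on_rho: "continuous_on {0..} (rho \<delta>0 \<delta>1 m)"
  unfolding rho_def using \<delta>0 by (intro continuous_intros continuous_on_lst) auto

lemma rho_attained:
  assumes "(1 - \<delta>1) ^ Suc m < x" "x \<le> (1 - \<delta>1) ^ m"
  obtains \<nu> where "0 \<le> \<nu>" "rho \<delta>0 \<delta>1 m \<nu> = x"
proof -
  \<comment> \<open>\<open>N\<close> is chosen so that \<open>\<delta>0 / N\<close> is the gap
    between \<open>x\<close> and the lower limit; the excess of \<open>rho\<close> over that limit
    at \<open>N\<close> is at most \<open>\<delta>0 / (\<delta>0 + N)\<close>, which is smaller. The
    intermediate value theorem then applies between 0 and \<open>N\<close>.\<close>
  define N where "N = \<delta>0 / (x - (1 - \<delta>1) ^ Suc m)"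
  have N: "0 < N" using assms \<delta>0 by (simp add: N_def)
  have "(1 - \<delta>1) ^ m * (\<delta>1 * (lst N ^ m * (\<delta>0 / (\<delta>0 + N)))) \<le> 1 * (1 * (1 * (\<delta>0 / (\<delta>0 + N))))"
    using \<delta>1 \<delta>0 N lst_pos[of N] lst_le_1[of N]
    by (intro mult_mono power_le_one mult_nonneg_nonneg) auto
  also have "\<dots> \<le> \<delta>0 / N"
    using \<delta>0 N by (simp add: frac_le)
  also have "\<dots> = x - (1 - \<delta>1) ^ Suc m"
    using \<delta>0 by (simp add: N_def)
  finally have "rho \<delta>0 \<delta>1 m N \<le> x"
    by (simp add: rho_def distrib_left mult.commute)
  moreover have "x \<le> rho \<delta>0 \<delta>1 m 0"
    using assms by (simp add: rho_0)
  moreover have "continuous_on {0..N} (rho \<delta>0 \<delta>1 m)"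
    by (rule continuous_on_subset[OF continuous_on_rho]) auto
  ultimately obtain \<nu> where "0 \<le> \<nu>" "rho \<delta>0 \<delta>1 m \<nu> = x"
    using IVT2'[of "rho \<delta>0 \<delta>1 m" N x 0] N by auto
  then show thesis by (rule that)
qed

end

end

section \<open>Normalisation, idle probability and support of the stationary distribution\<close>

context pull_chain
begin

abbreviation \<rho> :: real where "\<rho> \<equiv> rho \<delta>0 \<delta>1 m \<nu>"

lemma rho_bounds: "0 < \<rho>" "\<rho> \<le> 1"
  using rho_gt[OF \<delta>1 \<delta>0 \<nu>, of m] rho_le[OF \<delta>1 \<delta>0 \<nu>, of m] \<delta>1
    power_le_one[of "1 - \<delta>1" m] zero_less_power[of "1 - \<delta>1" "Suc m"]
  by linarith+

lemma geometric_sum: "(\<Sum>q=1..n. r ^ (n - q)) * \<delta>1 = 1 - r ^ n"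
proof (induction n)
  case (Suc n)
  have "(\<Sum>q=1..n. r ^ (Suc n - q)) = r * (\<Sum>q=1..n. r ^ (n - q))"
    by (simp add: sum_distrib_left Suc_diff_le)
  then have "(\<Sum>q=1..Suc n. r ^ (Suc n - q)) * \<delta>1 = r * ((\<Sum>q=1..n. r ^ (n - q)) * \<delta>1) + (1 - r)"
    by (simp add: distrib_right r_def)
  then show ?case unfolding Suc by (simp add: algebra_simps)
qed simp

text \<open>Pairing low row \<open>q\<close> with high row \<open>q + 1\<close> leaves a geometric
  sum and the unpaired \<open>high_row 1\<close>. With \<open>w = 1\<close> this gives the busy
  mass, with \<open>w = s\<close> the completion flow, whose multiple by \<open>\<delta>1\<close> is
  the update flow from busy servers.\<close>

lemma busy_weight:
  assumes "\<alpha> \<bullet> (K 0 *v w) = 1"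
  shows "\<delta>1 * ((\<Sum>q=1..m. low_row q \<bullet> w) + (\<Sum>q=1..Suc m. high_row q \<bullet> w)) = 1 - \<rho>"
proof -
  define X where "X = \<delta>0 / (\<delta>0 + \<nu>)"
  have "(\<Sum>q=1..Suc m. high_row q \<bullet> w) = high_row 1 \<bullet> w + (\<Sum>q=1..m. high_row (Suc q) \<bullet> w)"
    by (subst sum.atLeast_Suc_atMost) (simp_all add: sum.shift_bounds_cl_Suc_ivl del: sum.cl_ivl_Suc)
  moreover have "(\<Sum>q=1..m. low_row q \<bullet> w) + (\<Sum>q=1..m. high_row (Suc q) \<bullet> w) = (\<Sum>q=1..m. r ^ (m - q))"
    unfolding sum.distrib[symmetric] by (intro sum.cong refl low_high_inner assms) auto
  ultimately have "(\<Sum>q=1..m. low_row q \<bullet> w) + (\<Sum>q=1..Suc m. high_row q \<bullet> w) =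
      (\<Sum>q=1..m. r ^ (m - q)) + high_row 1 \<bullet> w"
    by linarith
  then have "\<delta>1 * ((\<Sum>q=1..m. low_row q \<bullet> w) + (\<Sum>q=1..Suc m. high_row q \<bullet> w)) =
      (\<Sum>q=1..m. r ^ (m - q)) * \<delta>1 + \<delta>1 * (high_row 1 \<bullet> w)"
    by (simp only: distrib_left mult.commute)
  also have "\<dots> = 1 - r ^ m + \<delta>1 * (r ^ m * (1 - L ^ m) + \<nu> * idle_prob)"
    unfolding geometric_sum high_row_1_inner[OF assms] ..
  also have "\<nu> * idle_prob = r ^ m * (L ^ m - L ^ m * X)"
    using \<delta>0 \<nu> by (simp add: X_def idle_prob_def power_mult_distrib field_simps)
  finally show ?thesis
    unfolding rho_def X_def[symmetric] r_def by (simp add: algebra_simps del: sum.cl_ivl_Suc)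
qed

text \<open>The left side is the update flow from idle servers; as the total update flow is 1, this
  is what identifies \<open>rho\<close> as the fraction of updates sent while idle.\<close>

lemma sol_idle: "\<delta>0 * (sol (Idle m) + sol (Idle (Suc m))) = \<rho>"
proof -
  define X where "X = \<delta>0 / (\<delta>0 + \<nu>)"
  have "\<delta>0 * (sol (Idle m) + sol (Idle (Suc m))) = \<delta>0 * idle_prob + r * (high_row 1 \<bullet> s)"
    using \<delta>0 by (simp add: distrib_left)
  also have "high_row 1 \<bullet> s = r ^ m * (1 - L ^ m) + \<nu> * idle_prob"
    by (rule high_row_1_inner[OF alpha_K0(2)])
  also have "\<nu> * idle_prob = r ^ m * (L ^ m - L ^ m * X)"
    using \<delta>0 \<nu> by (simp add: X_def idle_prob_def power_mult_distrib field_simps)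
  also have "\<delta>0 * idle_prob = r ^ m * (L ^ m * X)"
    by (simp add: X_def idle_prob_def power_mult_distrib)
  finally show ?thesis
    unfolding rho_def X_def[symmetric] r_def by (simp add: algebra_simps del: sol.simps)
qed

lemma sum_sol: "(\<Sum>x\<in>states. sol x) = \<rho> / \<delta>0 + (1 - \<rho>) / \<delta>1"
proof -
  let ?B = "(\<Sum>q=1..m. low_row q \<bullet> 1) + (\<Sum>q=1..Suc m. high_row q \<bullet> 1)"
  have "(\<Sum>x\<in>states. sol x) = sol (Idle m) + sol (Idle (Suc m)) + ?B"
    unfolding sum_pull_states inner_one by simp
  also have "?B = (1 - \<rho>) / \<delta>1"
    unfolding busy_weight[OF alpha_K0(1), symmetric] using \<delta>1 by (subst nonzero_mult_div_cancel_left) auto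
  also have "sol (Idle m) + sol (Idle (Suc m)) = \<rho> / \<delta>0"
    unfolding sol_idle[symmetric] using \<delta>0 by (subst nonzero_mult_div_cancel_left) auto
  finally show ?thesis .
qed

text \<open>The consistency check left open by treating the update flow as a free parameter: the
  solution computed for flow 1 does generate flow 1.\<close>

lemma reset_flow_sol: "reset_flow sol = 1"
proof -
  have "reset_flow sol = \<delta>0 * (sol (Idle m) + sol (Idle (Suc m))) +
      \<delta>1 * ((\<Sum>q=1..m. low_row q \<bullet> s) + (\<Sum>q=1..Suc m. high_row q \<bullet> s))"
    unfolding reset_flow_def sum_pull_states
    by (simp add: inner_vec_def sum_distrib_left algebra_simps del: sum.cl_ivl_Suc)
  also have "\<dots> = 1"
    unfolding sol_idle busy_weight[OF alpha_K0(2)] by simp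
  finally show ?thesis .
qed

lemma sum_sol_pos: "0 < (\<Sum>x\<in>states. sol x)"
  unfolding sum_sol using rho_bounds \<delta>0 \<delta>1 by (simp add: add_pos_nonneg)

lemma balanced_scale:
  assumes "balanced 1 p"
  shows "balanced c (\<lambda>x. c * p x)"
proof -
  have [simp]: "level (\<lambda>x. c * p x) q e = c *\<^sub>R level p q e" for q e
    by (simp add: vec_eq_iff)
  have eqs: "(\<delta>0 + \<nu>) * p (Idle m) = r * (level p 1 m \<bullet> s) + (if m = 0 then 1 else 0)"
    "\<delta>0 * p (Idle (Suc m)) = r * (level p 1 (Suc m) \<bullet> s)"
    "\<And>q. q\<in>{1..m} \<Longrightarrow> level p q m = (r * (level p (Suc q) m \<bullet> s) + (if q = m then 1 else 0)) *\<^sub>R (\<alpha> v* K \<nu>)"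
    "\<And>q. q\<in>{1..Suc m} \<Longrightarrow> level p q (Suc m) = ((r * (level p (Suc q) (Suc m) \<bullet> s)) *\<^sub>R \<alpha> +
       \<nu> *\<^sub>R (if q = 1 then p (Idle m) *\<^sub>R \<alpha> else level p (q - 1) m)) v* K 0"
    and supp: "\<And>x. x \<notin> states \<Longrightarrow> p x = 0"
    using assms unfolding balanced_def by blast+
  show ?thesis
    unfolding balanced_def
  proof (intro conjI ballI allI impI)
    show "(\<delta>0 + \<nu>) * (c * p (Idle m)) = r * (level (\<lambda>x. c * p x) 1 m \<bullet> s) + (if m = 0 then c else 0)"
      using arg_cong[OF eqs(1), of "(*) c"] by (simp add: distrib_left mult_ac)
    show "\<delta>0 * (c * p (Idle (Suc m))) = r * (level (\<lambda>x. c * p x) 1 (Suc m) \<bullet> s)"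
      using arg_cong[OF eqs(2), of "(*) c"] by (simp add: mult_ac)
  next
    fix q assume q: "q \<in> {1..m}"
    show "level (\<lambda>x. c * p x) q m =
        (r * (level (\<lambda>x. c * p x) (Suc q) m \<bullet> s) + (if q = m then c else 0)) *\<^sub>R (\<alpha> v* K \<nu>)"
      using arg_cong[OF eqs(3)[OF q], of "(*\<^sub>R) c"] by (simp add: distrib_left mult_ac)
  next
    fix q assume q: "q \<in> {1..Suc m}"
    have "c *\<^sub>R level p q (Suc m) = (c *\<^sub>R ((r * (level p (Suc q) (Suc m) \<bullet> s)) *\<^sub>R \<alpha> +
       \<nu> *\<^sub>R (if q = 1 then p (Idle m) *\<^sub>R \<alpha> else level p (q - 1) m))) v* K 0"
      unfolding scaleR_vector_matrix_assoc by (subst eqs(4)[OF q]) (rule refl)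
    then show "level (\<lambda>x. c * p x) q (Suc m) = ((r * (level (\<lambda>x. c * p x) (Suc q) (Suc m) \<bullet> s)) *\<^sub>R \<alpha> +
       \<nu> *\<^sub>R (if q = 1 then (c * p (Idle m)) *\<^sub>R \<alpha> else level (\<lambda>x. c * p x) (q - 1) m)) v* K 0"
      by (simp add: scaleR_add_right mult_ac if_distrib[of "(*\<^sub>R) c"] cong: if_cong)
  qed (simp add: supp)
qed

text \<open>\<open>balanced_unique\<close> leaves only a scalar, which the total mass fixes;
  conversely the scaled solution has the right update flow by \<open>reset_flow_sol\<close>.
  Existence and uniqueness together give meaning to the \<open>THE\<close> in
  \<open>stationary_dist\<close>.\<close>

lemma is_stationary_iff_sol:
  "is_stationary \<alpha> S \<delta>0 \<delta>1 m \<nu> p \<longleftrightarrow> p = (\<lambda>x. 1 / (\<Sum>y\<in>states. sol y) * sol x)"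
proof
  assume "is_stationary \<alpha> S \<delta>0 \<delta>1 m \<nu> p"
  then have sum: "(\<Sum>x\<in>states. p x) = 1" and p: "\<And>x. p x = reset_flow p * sol x"
    using balanced_unique by (auto simp: is_stationary_iff)
  have "reset_flow p * (\<Sum>y\<in>states. sol y) = (\<Sum>x\<in>states. p x)"
    unfolding sum_distrib_left by (intro sum.cong refl p[symmetric])
  with sum have "reset_flow p = 1 / (\<Sum>y\<in>states. sol y)"
    using sum_sol_pos by (simp add: field_simps)
  then show "p = (\<lambda>x. 1 / (\<Sum>y\<in>states. sol y) * sol x)"
    using p by (intro ext) simp
next
  define c where "c = 1 / (\<Sum>y\<in>states. sol y)"
  assume "p = (\<lambda>x. 1 / (\<Sum>y\<in>states. sol y) * sol x)"
  then have p: "p = (\<lambda>x. c * sol x)" by (simp add: c_def)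
  have "reset_flow p = c * reset_flow sol"
    by (simp add: p reset_flow_def sum_distrib_left mult_ac)
  moreover have "0 \<le> c" "c * (\<Sum>y\<in>states. sol y) = 1"
    using sum_sol_pos by (auto simp: c_def)
  ultimately show "is_stationary \<alpha> S \<delta>0 \<delta>1 m \<nu> p"
    unfolding is_stationary_iff
    using balanced_scale[OF balanced_sol, of c] sol_nonneg
    by (simp add: p reset_flow_sol flip: sum_distrib_left)
qed

lemma stationary_dist_eq:
  "stationary_dist \<alpha> S \<delta>0 \<delta>1 m \<nu> = (\<lambda>x. 1 / (\<Sum>y\<in>states. sol y) * sol x)"
  unfolding stationary_dist_def is_stationary_iff_sol by (rule the_equality) auto

lemma queue_prob_eq:
  "queue_prob \<alpha> S \<delta>0 \<delta>1 q m \<nu> =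
    (\<Sum>x\<in>{x \<in> states. queue_length x = q}. sol x) / (\<Sum>x\<in>states. sol x)"
  by (simp add: queue_prob_def stationary_dist_eq sum_divide_distrib)

lemma queue_prob_0:
  "queue_prob \<alpha> S \<delta>0 \<delta>1 0 m \<nu> = \<delta>1 * \<rho> / (\<delta>1 * \<rho> + \<delta>0 * (1 - \<rho>))"
proof -
  have "x \<in> states \<and> queue_length x = 0 \<longleftrightarrow> x = Idle m \<or> x = Idle (Suc m)" for x
    by (cases x) auto
  then have "{x \<in> states. queue_length x = 0} = {Idle m, Idle (Suc m)}"
    by (simp only: set_eq_iff mem_Collect_eq insert_iff empty_iff) simp
  then have "(\<Sum>x\<in>{x \<in> states. queue_length x = 0}. sol x) = \<rho> / \<delta>0"
    unfolding sol_idle[symmetric] using \<delta>0 by (simp del: sol.simps)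
  then show ?thesis
    unfolding queue_prob_eq sum_sol using \<delta>0 \<delta>1 by (simp add: field_simps)
qed

lemma queue_prob_pos_iff:
  "0 < queue_prob \<alpha> S \<delta>0 \<delta>1 q m \<nu> \<longleftrightarrow> (\<exists>x\<in>states. queue_length x = q \<and> sol x \<noteq> 0)"
proof -
  have "0 < queue_prob \<alpha> S \<delta>0 \<delta>1 q m \<nu> \<longleftrightarrow> 0 < (\<Sum>x\<in>{x \<in> states. queue_length x = q}. sol x)"
    unfolding queue_prob_eq using sum_sol_pos by (simp add: zero_less_divide_iff)
  also have "\<dots> \<longleftrightarrow> (\<Sum>x\<in>{x \<in> states. queue_length x = q}. sol x) \<noteq> 0"
    using sum_nonneg[of "{x \<in> states. queue_length x = q}" sol] sol_nonneg by auto
  also have "\<dots> \<longleftrightarrow> (\<exists>x\<in>states. queue_length x = q \<and> sol x \<noteq> 0)"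
    using sol_nonneg by (subst sum_nonneg_eq_0_iff) auto
  finally show ?thesis .
qed

lemma alpha_row_K_nonzero: "0 \<le> \<mu> \<Longrightarrow> \<alpha> v* K \<mu> \<noteq> 0"
  using K_solve[of \<mu> 0 \<alpha>] K_solve[of \<mu> "\<alpha> v* K \<mu>" \<alpha>] alpha(2) by auto

text \<open>A queue of length \<open>Suc m\<close> can arise only from an assignment, so it has
  positive probability exactly when \<nu> is positive; without assignments the states reached by
  updates have length \<open>m\<close>.\<close>

lemma Max_queue_length:
  "Max {q. 0 < queue_prob \<alpha> S \<delta>0 \<delta>1 q m \<nu>} = (if \<nu> = 0 then m else Suc m)"
proof (rule Max_eqI)
  have le: "queue_length x \<le> Suc m" if "x \<in> states" for x
    using that by (cases x) auto
  then show "finite {q. 0 < queue_prob \<alpha> S \<delta>0 \<delta>1 q m \<nu>}"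
    by (auto simp: queue_prob_pos_iff intro: finite_subset[of _ "{..Suc m}"])
  fix q assume "q \<in> {q. 0 < queue_prob \<alpha> S \<delta>0 \<delta>1 q m \<nu>}"
  then obtain x where x: "x \<in> states" "queue_length x = q" "sol x \<noteq> 0"
    by (auto simp: queue_prob_pos_iff)
  have "sol x = 0" if \<nu>0: "\<nu> = 0" and q: "q = Suc m"
  proof -
    obtain j where j: "x = Busy (Suc m) (Suc m) j"
      using x q by (cases x) auto
    have "high_row (Suc m) = 0"
      unfolding high_row_def by (simp add: \<nu>0)
    then show ?thesis unfolding j by simp
  qed
  then show "q \<le> (if \<nu> = 0 then m else Suc m)"
    using le[OF x(1)] x by (auto simp: le_Suc_eq)
next
  show "(if \<nu> = 0 then m else Suc m) \<in> {q. 0 < queue_prob \<alpha> S \<delta>0 \<delta>1 q m \<nu>}"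
  proof (cases "\<nu> = 0")
    case False
    \<comment> \<open>At the top level the exponent \<open>Suc m - q\<close> is 0, so the first
      coefficient vanishes and only the assignment term remains.\<close>
    have "high_row (Suc m) = \<nu> *\<^sub>R ((if m = 0 then idle_prob *\<^sub>R \<alpha> else \<alpha> v* K \<nu>) v* K 0)"
      by (auto simp: high_row_def low_row_def)
    also have "\<dots> \<noteq> 0"
      using False idle_prob_pos alpha_row_K_nonzero[of 0] alpha_row_K_nonzero[OF \<nu>]
        K_solve[of 0 0 "\<alpha> v* K \<nu>"]
      by (auto simp: scaleR_vector_matrix_assoc)
    finally obtain j where "high_row (Suc m) $ j \<noteq> 0"
      by (auto simp: vec_eq_iff)
    then have "\<exists>x\<in>states. queue_length x = Suc m \<and> sol x \<noteq> 0"
      by (intro bexI[of _ "Busy (Suc m) (Suc m) j"]) auto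
    with False show ?thesis by (simp add: queue_prob_pos_iff)
  next
    case True
    have "\<exists>x\<in>states. queue_length x = m \<and> sol x \<noteq> 0"
    proof (cases "m = 0")
      case True
      show ?thesis
      proof (intro bexI conjI)
        show "queue_length (Idle m) = m" using True by simp
        show "sol (Idle m) \<noteq> 0" using idle_prob_pos by simp
      qed simp
    next
      case False
      obtain j where "(\<alpha> v* K \<nu>) $ j \<noteq> 0"
        using alpha_row_K_nonzero[OF \<nu>] by (auto simp: vec_eq_iff)
      with False show ?thesis
        by (intro bexI[of _ "Busy m m j"]) (auto simp: low_row_def)
    qed
    then show ?thesis
      unfolding mem_Collect_eq queue_prob_pos_iff if_P[OF True] .
  qed
qed

end

section \<open>From idle probabilities to rounded logarithms\<close>

text \<open>After cross-multiplication the mixed terms cancel and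
  \<open>a * b * x < a * b * y\<close> remains. The idle probability thus determines
  \<open>rho\<close> and preserves its order.\<close>

lemma idle_odds_strict_mono:
  fixes a b x y :: real
  assumes "0 < a" "0 < b" "0 \<le> x" "x < y" "y \<le> 1"
  shows "a * x / (a * x + b * (1 - x)) < a * y / (a * y + b * (1 - y))"
proof -
  have "0 < a * x + b * (1 - x)"
    using assms by (intro add_nonneg_pos mult_nonneg_nonneg mult_pos_pos) auto
  moreover have "0 < a * y + b * (1 - y)"
    using assms by (intro add_pos_nonneg mult_nonneg_nonneg mult_pos_pos) auto
  moreover have "a * b * x < a * b * y"
    using assms by simp
  ultimately show ?thesis
    by (simp add: frac_less_eq divide_simps algebra_simps)
qed

text \<open>Dividing by the negative number \<open>ln r\<close> reverses the inequalities. This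
  translates positions between powers of \<open>r\<close> into floor and ceiling of a quotient of
  logarithms.\<close>

lemma power_bracket_iff:
  fixes r x :: real
  assumes "0 < r" "r < 1" "0 < x"
  shows "x \<le> r ^ n \<longleftrightarrow> real n \<le> ln x / ln r" "x < r ^ n \<longleftrightarrow> real n < ln x / ln r"
proof -
  have r: "ln r < 0" using assms by simp
  have "x \<le> r ^ n \<longleftrightarrow> ln x \<le> n * ln r"
    using assms by (simp flip: ln_realpow)
  then show "x \<le> r ^ n \<longleftrightarrow> real n \<le> ln x / ln r"
    using r by (simp add: neg_le_divide_eq)
  have "x < r ^ n \<longleftrightarrow> ln x < n * ln r"
    using assms by (simp flip: ln_realpow)
  then show "x < r ^ n \<longleftrightarrow> real n < ln x / ln r"
    using r by (simp add: neg_less_divide_eq)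
qed

theorem theorem6p2:
  fixes \<alpha> :: "real^'n" and S :: "real^'n^'n" and lam \<delta>0 \<delta>1 \<delta> mt :: real
  assumes "0 \<le> lam" and "lam < 1"
    and "0 < \<delta>1" and "\<delta>1 < 1" and "0 < \<delta>0"
    and "\<delta> = lam * \<delta>1 + (1 - lam) * \<delta>0"
    and "phase_type \<alpha> S" and "ph_mean \<alpha> S = 1"
    and "mt = ln (1 - lam * \<delta>1 / \<delta>) / ln (1 - \<delta>1)"
  shows "1 - lam \<in> {queue_prob \<alpha> S \<delta>0 \<delta>1 0 (nat \<lceil>mt\<rceil>) 0 .. queue_prob \<alpha> S \<delta>0 \<delta>1 0 (nat \<lfloor>mt\<rfloor>) 0}
       \<and> int (cavity_max_queue_length \<alpha> S \<delta>0 \<delta>1 lam) = \<lceil>mt\<rceil>"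
proof -
  interpret phase_type_dist \<alpha> S
    by unfold_locales (fact assms)+
  have chain: "pull_chain \<alpha> S \<delta>0 \<delta>1 \<nu> " if "0 \<le> \<nu>" for \<nu>
    by unfold_locales (use assms that in auto)
  \<comment> \<open>\<open>g\<close> maps the fraction of updates sent while idle to the idle
    probability; \<open>x\<close> below is its preimage of \<open>1 - lam\<close>.\<close>
  define g where "g x = \<delta>1 * x / (\<delta>1 * x + \<delta>0 * (1 - x))" for x
  define r where "r = 1 - \<delta>1"
  define x where "x = 1 - lam * \<delta>1 / \<delta>"
  have r: "0 < r" "r < 1" using assms by (auto simp: r_def)
  have \<delta>: "0 < \<delta>"
    using assms by (simp add: add_nonneg_pos)
  have x: "x = (1 - lam) * \<delta>0 / \<delta>"
    using \<delta> assms(6) by (simp add: x_def field_simps)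
  have x01: "0 < x" "x \<le> 1"
    using assms \<delta> by (simp add: x, simp add: x_def)
  have gx: "g x = 1 - lam"
  proof -
    have "\<delta>1 * x + \<delta>0 * (1 - x) = \<delta>1 * \<delta>0 / \<delta>"
      using \<delta> unfolding x by (simp add: field_simps) (simp add: assms(6) algebra_simps)
    then show ?thesis
      using assms \<delta> by (simp add: g_def x)
  qed
  have g_mono: "g a \<le> g b \<longleftrightarrow> a \<le> b" if "0 \<le> a" "a \<le> 1" "0 \<le> b" "b \<le> 1" for a b
    using idle_odds_strict_mono[of \<delta>1 \<delta>0 a b] idle_odds_strict_mono[of \<delta>1 \<delta>0 b a] assms that
    unfolding g_def by (smt (verit))
  have g_inj: "g a = g b \<longleftrightarrow> a = b" if "0 \<le> a" "a \<le> 1" "0 \<le> b" "b \<le> 1" for a b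
    using g_mono[of a b] g_mono[of b a] that by (metis order_antisym order_refl)
  have mt: "mt = ln x / ln r"
    using assms by (simp add: x_def r_def)
  have mt0: "0 \<le> mt"
    unfolding mt using x01 r by (intro divide_nonpos_neg) auto
  note bracket = power_bracket_iff[OF r x01(1), folded mt]
  have q0: "queue_prob \<alpha> S \<delta>0 \<delta>1 0 m \<nu> = g (rho \<delta>0 \<delta>1 m \<nu>)" if "0 \<le> \<nu>" for m \<nu>
    using pull_chain.queue_prob_0[OF chain[OF that]] by (simp add: g_def)
  have rho01: "0 \<le> rho \<delta>0 \<delta>1 m \<nu>" "rho \<delta>0 \<delta>1 m \<nu> \<le> 1" if "0 \<le> \<nu>" for m \<nu>
    using pull_chain.rho_bounds[OF chain[OF that]] by (auto intro: less_imp_le)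
  have rpow: "0 \<le> r ^ n" "r ^ n \<le> 1" for n
    using r by (auto intro: power_le_one)
  note rho = rho_gt[OF assms(3-5), folded r_def] rho_le[OF assms(3-5), folded r_def]
    rho_strict_antimono[OF assms(3-5)] rho_0[OF assms(3-5), folded r_def]
  have "x \<le> r ^ nat \<lfloor>mt\<rfloor>"
    unfolding bracket using mt0 by simp
  then have "1 - lam \<le> queue_prob \<alpha> S \<delta>0 \<delta>1 0 (nat \<lfloor>mt\<rfloor>) 0"
    using x01 rpow by (simp add: q0 rho gx[symmetric] g_mono)
  moreover have "r ^ nat \<lceil>mt\<rceil> \<le> x"
    using bracket(2)[of "nat \<lceil>mt\<rceil>"] mt0 by linarith
  then have "queue_prob \<alpha> S \<delta>0 \<delta>1 0 (nat \<lceil>mt\<rceil>) 0 \<le> 1 - lam"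
    using x01 rpow by (simp add: q0 rho gx[symmetric] g_mono)
  moreover have "int (cavity_max_queue_length \<alpha> S \<delta>0 \<delta>1 lam) = \<lceil>mt\<rceil>"
  proof -
    define m where "m = nat \<lfloor>mt\<rfloor>"
    \<comment> \<open>The floor selects the one half-open interval between consecutive powers of
      \<open>r\<close> that contains \<open>x\<close>.\<close>
    have "x \<le> r ^ m" "r ^ Suc m < x"
      using bracket(1)[of m] bracket(1)[of "Suc m"] mt0 by (auto simp: m_def not_le[symmetric]) linarith+
    then obtain \<nu> where \<nu>: "0 \<le> \<nu>" "rho \<delta>0 \<delta>1 m \<nu> = x"
      using rho_attained[OF assms(3-5), folded r_def] by blast
    have solves: "queue_prob \<alpha> S \<delta>0 \<delta>1 0 n \<mu> = 1 - lam \<longleftrightarrow> rho \<delta>0 \<delta>1 n \<mu> = x" if "0 \<le> \<mu>" for n \<mu>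
      unfolding q0[OF that] gx[symmetric] using rho01[OF that] x01 by (intro g_inj) auto
    have "cavity_parameters \<alpha> S \<delta>0 \<delta>1 lam = (m, \<nu>)"
      unfolding cavity_parameters_def
    proof (rule the_equality)
      show "0 \<le> snd (m, \<nu>) \<and> queue_prob \<alpha> S \<delta>0 \<delta>1 0 (fst (m, \<nu>)) (snd (m, \<nu>)) = 1 - lam"
        using \<nu> solves by simp
      fix p assume p: "0 \<le> snd p \<and> queue_prob \<alpha> S \<delta>0 \<delta>1 0 (fst p) (snd p) = 1 - lam"
      obtain n \<mu> where [simp]: "p = (n, \<mu>)" by (cases p)
      have \<mu>: "0 \<le> \<mu>" "rho \<delta>0 \<delta>1 n \<mu> = x"
        using p solves by auto
      \<comment> \<open>Any competing solution places \<open>x\<close> in the interval of its own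
        \<open>n\<close>, which forces \<open>n = m\<close>; strict monotonicity of
        \<open>rho\<close> then fixes the rate.\<close>
      then have "x \<le> r ^ n" "r ^ Suc n < x"
        using rho(1,2)[of \<mu> n] by auto
      then have "n = m"
        using bracket(1)[of n] bracket(1)[of "Suc n"] mt0 unfolding m_def by linarith
      moreover have "\<mu> = \<nu>"
        using rho(3)[of \<mu> \<nu> m] rho(3)[of \<nu> \<mu> m] \<mu> \<nu> \<open>n = m\<close> by (cases \<mu> \<nu> rule: linorder_cases) auto
      ultimately show "p = (m, \<nu>)" by simp
    qed
    then have "cavity_max_queue_length \<alpha> S \<delta>0 \<delta>1 lam = (if \<nu> = 0 then m else Suc m)"
      using pull_chain.Max_queue_length[OF chain[OF \<nu>(1)]] by (simp add: cavity_max_queue_length_def)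
    \<comment> \<open>The rate is 0 exactly when \<open>x\<close> is the right end point
      \<open>r ^ m\<close>, that is, when \<open>mt\<close> is an integer. Then \<open>m\<close> is
      the ceiling of \<open>mt\<close>; otherwise \<open>Suc m\<close> is.\<close>
    moreover have "\<nu> = 0 \<longleftrightarrow> \<not> real m < mt"
      unfolding bracket(2)[symmetric] using rho(3)[of 0 \<nu> m] \<nu> by (cases "\<nu> = 0") (auto simp: rho(4))
    ultimately show ?thesis
      using mt0 unfolding m_def by (auto split: if_splits) linarith+
  qed
  ultimately show ?thesis by simp
qed

end
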